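(* Let $\mathcal I$ be a nominal model for the simply-typed $\lambda$-calculus with holes. If $\Gamma\models\varsigma$ and $\Gamma\vdash r:\phi$, then $[\![r]\!]_{\varsigma;\Gamma}\in\mathcal I_\Gamma(\phi)$.
   Context: Atoms and nominal sets: a countably infinite set $\mathbb A$ of atoms partitioned into disjoint countably infinite sets $\mathbb A=\mathbb A_{\mathrm d}\uplus\mathbb A_{\mathrm u}$; permutations are bijections of $\mathbb A$ moving finitely many atoms, acting on ZFA sets by $\pi\cdot a=\pi(a)$, $\pi\cdot X=\{\pi\cdot x\mid x\in X\}$; $\mathrm{supp}(x)$ is the least finite set $A$ such that every permutation fixing $A$ pointwise fixes $x$; $a\#x$ means $a\notin\mathrm{supp}(x)$; $(a\ b)$ is a swapping. Syntax: unknowns $X,Y,\dots$; types $\phi::=\tau\mid\phi\to\phi$; constants $C$ with types $\mathrm{type}(C)$; terms $r::=a\mid C\mid X[b_i{:=}s_i]_{i=1}^n\mid\lambda c{:}\phi.s\mid rs$ with $\{b_i\}\subseteq\mathbb A_{\mathrm d}$ distinct, $c\in\mathbb A_{\mathrm u}$, up to $\alpha$-equivalence. Type environments $\Gamma$: functional sets of typings $a{:}\phi$ and $X{:}\phi$; $\mathrm{dom}(\Gamma)$. Typing rules: $\Gamma\vdash a:\phi$ if $a{:}\phi\in\Gamma$; $\Gamma\vdash C:\mathrm{type}(C)$; from $\Gamma,a{:}\phi\vdash r:\psi$ with $a\in\mathbb A_{\mathrm u}$ infer $\Gamma\vdash\lambda a{:}\phi.r:\phi\to\psi$; from $\Gamma\vdash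 r:\phi\to\psi$, $\Gamma\vdash s:\phi$ infer $\Gamma\vdash rs:\psi$; (Meta) if $X{:}\phi\in\Gamma$, $b_i{:}\psi_i\in\Gamma$, $\Gamma\vdash s_i:\psi_i$ ($1\le i\le n$) then $\Gamma\vdash X[b_i{:=}s_i]_1^n:\phi$. Model: $\mathcal I$ assigns to each $\Gamma,\phi$ a finitely-supported set $\mathcal I_\Gamma(\phi)$, with $a^{\mathcal I}_\phi\in\mathcal I_\Gamma(\phi)$ for $a{:}\phi\in\Gamma$, $C^{\mathcal I}\in\mathcal I_\Gamma(\mathrm{type}(C))$, abstraction $[a{:}\phi]x\in\mathcal I_\Gamma(\phi\to\psi)$ for $x\in\mathcal I_{\Gamma,a:\phi}(\psi)$, application $x\bullet y\in\mathcal I_\Gamma(\psi)$ for $x\in\mathcal I_\Gamma(\phi\to\psi),y\in\mathcal I_\Gamma(\phi)$; satisfying $\mathcal I_{\Gamma\cap\Gamma'}(\phi)=\mathcal I_\Gamma(\phi)\cap\mathcal I_{\Gamma'}(\phi)$; $\mathrm{supp}(x)\subseteq\mathrm{dom}(\Gamma)$ for $x\in\mathcal I_\Gamma(\phi)$; $\mathcal I_\Gamma(\phi)=\mathcal I_{\Gamma'}(\phi)$ whenever $\Gamma,\Gamma'$ assign the same types to all atoms; equivariance for all permutations of the sets and data; and with $x[a\mapsto y]:=([a{:}\phi]x)\bullet y$: $a^{\mathcal I}_\phi[a\mapsto x]=x$; $a\#z\Rightarrow z[a\mapsto x]=z$; $(z'\bullet z)[a\mapsto x]=(z'[a\mapsto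 x])\bullet(z[a\mapsto x])$; $c\#x\Rightarrow([c{:}\chi]z)[a\mapsto x]=[c{:}\chi](z[a\mapsto x])$. Simultaneous substitution $x[b_i\mapsto y_i]_1^n:=\bigl(((c_1\ b_1)\circ\dots\circ(c_n\ b_n))\cdot x\bigr)[c_1\mapsto y_1]\cdots[c_n\mapsto y_n]$ for fresh distinct $c_i\notin\mathrm{supp}(x)\cup\bigcup_i\mathrm{supp}(y_i)$. Valuations: a valuation $\varsigma$ is a function on unknowns with $\mathrm{supp}(\varsigma(X))\subseteq\mathbb A_{\mathrm d}$ for all $X$; $\Gamma\models\varsigma$ means $X{:}\phi\in\Gamma$ implies $\varsigma(X)\in\mathcal I_\Gamma(\phi)$. Interpretation for $\Gamma\vdash r:\phi$: $[\![a]\!]_{\varsigma;\Gamma}=a^{\mathcal I}_\phi$ ($a{:}\phi\in\Gamma$); $[\![C]\!]_{\varsigma;\Gamma}=C^{\mathcal I}$; $[\![\lambda a{:}\phi.r]\!]_{\varsigma;\Gamma}=[a{:}\phi][\![r]\!]_{\varsigma;\Gamma,a:\phi}$ ($a\in\mathbb A_{\mathrm u}\setminus\mathrm{dom}(\Gamma)$); $[\![rs]\!]_{\varsigma;\Gamma}=[\![r]\!]_{\varsigma;\Gamma}\bullet[\![s]\!]_{\varsigma;\Gamma}$; $[\![X[b_i{:=}s_i]_i]\!]_{\varsigma;\Gamma}=\varsigma(X)[b_i\mapsto[\![s_i]\!]_{\varsigma;\Gamma}]_i$ ($X{:}\phi\in\Gamma$).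
   Formalization: Type environments are required to type only finitely many atoms (any number of unknowns); otherwise the clause for λ may have no atom in A_u \ dom(Γ), and finitely-supported I_Γ(φ) for infinite co-infinite Γ force one-point models. *)

theory Defs
  imports "HOL-Combinatorics.Perm"
begin

unbundle permutation_syntax

section \<open>Atoms, permutation actions and support\<close>

datatype atom = Atom_d nat | Atom_u nat

definition Ad :: "atom set" where "Ad = range Atom_d"
definition Au :: "atom set" where "Au = range Atom_u"

text \<open>
  A permutation action on a type is given by a function \<open>act :: atom perm \<Rightarrow> 'd \<Rightarrow> 'd\<close>; the
  library type \<^typ>\<open>atom perm\<close> consists of the bijections that move finitely many atoms.
\<close>

definition supports :: "(atom perm \<Rightarrow> 'd \<Rightarrow> 'd) \<Rightarrow> atom set \<Rightarrow> 'd \<Rightarrow> bool" where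
  "supports act A x \<longleftrightarrow> (\<forall>\<pi>. (\<forall>a\<in>A. \<pi> \<langle>$\<rangle> a = a) \<longrightarrow> act \<pi> x = x)"

definition fin_supp :: "(atom perm \<Rightarrow> 'd \<Rightarrow> 'd) \<Rightarrow> 'd \<Rightarrow> bool" where
  "fin_supp act x \<longleftrightarrow> (\<exists>A. finite A \<and> supports act A x)"

text \<open>Meaningful only for \<open>x\<close> with \<^const>\<open>fin_supp\<close>; for sets, \<open>\<le>\<close> is inclusion.\<close>

definition supp :: "(atom perm \<Rightarrow> 'd \<Rightarrow> 'd) \<Rightarrow> 'd \<Rightarrow> atom set" where
  "supp act x = (LEAST A. finite A \<and> supports act A x)"


section \<open>Types and terms\<close>

datatype 'b ty = Base 'b | Fun "'b ty" "'b ty"  (infixr \<open>\<rightarrow>\<^sub>t\<close> 65)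

text \<open>
  Raw syntax over base types \<open>'b\<close>, constants \<open>'c\<close> and unknowns \<open>'x\<close>. Since only the parameter
  \<open>'a\<close> is live, \<open>map_raw f\<close> applies \<open>f\<close> to every atom, including binders and the \<open>b\<^sub>i\<close>.
\<close>

datatype ('a, dead 'b, dead 'c, dead 'x) raw =
    RAt 'a
  | RCon 'c
  | RUnk 'x "('a \<times> ('a, 'b, 'c, 'x) raw) list"
  | RLam 'a "'b ty" "('a, 'b, 'c, 'x) raw"
  | RApp "('a, 'b, 'c, 'x) raw" "('a, 'b, 'c, 'x) raw"

abbreviation distinct_Ad :: "(atom \<times> 't) list \<Rightarrow> bool" where
  "distinct_Ad \<sigma> \<equiv> distinct (map fst \<sigma>) \<and> fst ` set \<sigma> \<subseteq> Ad"

inductive grammar :: "(atom, 'b, 'c, 'x) raw \<Rightarrow> bool" where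
  "grammar (RAt a)"
| "grammar (RCon C)"
| "distinct_Ad \<sigma> \<Longrightarrow> \<forall>p\<in>set \<sigma>. grammar (snd p) \<Longrightarrow> grammar (RUnk X \<sigma>)"
| "c \<in> Au \<Longrightarrow> grammar r \<Longrightarrow> grammar (RLam c \<phi> r)"
| "grammar r \<Longrightarrow> grammar s \<Longrightarrow> grammar (RApp r s)"

text \<open>
  Alpha-equivalence: two abstractions are identified if their bodies agree after renaming the
  binders to \<open>c\<close>, for all but finitely many \<open>c \<in> Au\<close>. Only \<open>\<lambda>\<close> binds; the \<open>b\<^sub>i\<close> are not renamed.
\<close>

inductive alpha :: "(atom, 'b, 'c, 'x) raw \<Rightarrow> (atom, 'b, 'c, 'x) raw \<Rightarrow> bool" where
  alpha_At: "alpha (RAt a) (RAt a)"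
| alpha_Con: "alpha (RCon C) (RCon C)"
| alpha_Unk: "list_all2 (rel_prod (=) alpha) \<sigma> \<tau> \<Longrightarrow> alpha (RUnk X \<sigma>) (RUnk X \<tau>)"
| alpha_Lam: "finite L \<Longrightarrow>
    \<forall>c\<in>Au - L. alpha (map_raw (apply \<langle>c \<leftrightarrow> a\<rangle>) r) (map_raw (apply \<langle>c \<leftrightarrow> b\<rangle>) s) \<Longrightarrow>
    alpha (RLam a \<phi> r) (RLam b \<phi> s)"
| alpha_App: "alpha r r' \<Longrightarrow> alpha s s' \<Longrightarrow> alpha (RApp r s) (RApp r' s')"

inductive_cases alpha_elims:
  "alpha (RAt a) t" "alpha (RCon C) t" "alpha (RUnk X \<sigma>) t" "alpha (RLam a \<phi> r) t"
  "alpha (RApp r s) t"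

lemma alpha_sym: "alpha r s \<Longrightarrow> alpha s r"
proof (induction rule: alpha.induct)
  case (alpha_Unk \<sigma> \<tau> X)
  have "list_all2 (rel_prod (=) alpha) \<tau> \<sigma>"
    using alpha_Unk by (auto simp: list_all2_conv_all_nth rel_prod_sel)
  then show ?case by (rule alpha.alpha_Unk)
next
  case (alpha_Lam L a r b s \<phi>)
  then show ?case by (intro alpha.alpha_Lam[of L]) auto
qed (auto intro: alpha.intros)

lemma alpha_trans: "alpha r s \<Longrightarrow> alpha s t \<Longrightarrow> alpha r t"
proof (induction arbitrary: t rule: alpha.induct)
  case (alpha_Unk \<sigma> \<tau> X)
  from alpha_Unk.prems obtain \<rho> where t: "t = RUnk X \<rho>"
    and *: "list_all2 (rel_prod (=) alpha) \<tau> \<rho>"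
    by (auto elim: alpha_elims)
  have "list_all2 (rel_prod (=) alpha) \<sigma> \<rho>"
    using alpha_Unk.IH * by (auto simp: list_all2_conv_all_nth rel_prod_sel)
  then show ?case unfolding t by (rule alpha.alpha_Unk)
next
  case (alpha_Lam L a r b s \<phi>)
  from alpha_Lam.prems obtain L' d u where t: "t = RLam d \<phi> u" and L': "finite L'"
    and *: "\<forall>c\<in>Au - L'. alpha (map_raw (apply \<langle>c \<leftrightarrow> b\<rangle>) s) (map_raw (apply \<langle>c \<leftrightarrow> d\<rangle>) u)"
    by (auto elim: alpha_elims)
  show ?case unfolding t
    by (rule alpha.alpha_Lam[of "L \<union> L'"]) (use alpha_Lam.hyps alpha_Lam.IH L' * in auto)
qed (auto elim!: alpha_elims intro: alpha.intros)

quotient_type ('b, 'c, 'x) trm = "(atom, 'b, 'c, 'x) raw" /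
    partial: "\<lambda>r s. grammar r \<and> grammar s \<and> alpha r s"
proof (rule part_equivpI)
  show "\<exists>r. grammar r \<and> grammar r \<and> alpha r r"
    by (rule exI[of _ "RAt a" for a]) (auto intro: grammar.intros alpha.intros)
qed (auto intro!: sympI transpI intro: alpha_sym alpha_trans)

text \<open>
  \<open>Unk X \<sigma>\<close> and \<open>Lam a \<phi> r\<close> are meaningful only if \<^term>\<open>distinct_Ad \<sigma>\<close> and \<open>a \<in> Au\<close>; otherwise
  the raw term is outside the grammar and its class is unspecified.
\<close>

definition At :: "atom \<Rightarrow> ('b, 'c, 'x) trm" where
  "At a = abs_trm (RAt a)"
definition Con :: "'c \<Rightarrow> ('b, 'c, 'x) trm" where
  "Con C = abs_trm (RCon C)"
definition Unk :: "'x \<Rightarrow> (atom \<times> ('b, 'c, 'x) trm) list \<Rightarrow> ('b, 'c, 'x) trm" where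
  "Unk X \<sigma> = abs_trm (RUnk X (map (map_prod id rep_trm) \<sigma>))"
definition Lam :: "atom \<Rightarrow> 'b ty \<Rightarrow> ('b, 'c, 'x) trm \<Rightarrow> ('b, 'c, 'x) trm" where
  "Lam a \<phi> r = abs_trm (RLam a \<phi> (rep_trm r))"
definition App :: "('b, 'c, 'x) trm \<Rightarrow> ('b, 'c, 'x) trm \<Rightarrow> ('b, 'c, 'x) trm" where
  "App r s = abs_trm (RApp (rep_trm r) (rep_trm s))"


section \<open>Typing\<close>

text \<open>
  A set of typings: \<open>(Inl a, \<phi>)\<close> stands for \<open>a : \<phi>\<close> and \<open>(Inr X, \<phi>)\<close> for \<open>X : \<phi>\<close>.
  Environments mention finitely many atoms, so that fresh atoms exist for them; there is no
  restriction on the number of unknowns.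
\<close>

type_synonym ('b, 'x) env = "((atom + 'x) \<times> 'b ty) set"

definition dom_atoms :: "('b, 'x) env \<Rightarrow> atom set" where
  "dom_atoms \<Gamma> = {a. Inl a \<in> Domain \<Gamma>}"

definition type_env :: "('b, 'x) env \<Rightarrow> bool" where
  "type_env \<Gamma> \<longleftrightarrow> single_valued \<Gamma> \<and> finite (dom_atoms \<Gamma>)"

text \<open>\<open>\<Gamma>, a : \<phi>\<close>; always used under the requirement that the result is a type environment.\<close>

abbreviation env_ext :: "('b, 'x) env \<Rightarrow> atom \<Rightarrow> 'b ty \<Rightarrow> ('b, 'x) env" where
  "env_ext \<Gamma> a \<phi> \<equiv> insert (Inl a, \<phi>) \<Gamma>"

definition perm_env :: "atom perm \<Rightarrow> ('b, 'x) env \<Rightarrow> ('b, 'x) env" where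
  "perm_env \<pi> \<Gamma> = map_prod (map_sum (apply \<pi>) id) id ` \<Gamma>"

inductive typing ::
  "('c \<Rightarrow> 'b ty) \<Rightarrow> ('b, 'x) env \<Rightarrow> ('b, 'c, 'x) trm \<Rightarrow> 'b ty \<Rightarrow> bool"
  for type :: "'c \<Rightarrow> 'b ty" where
  typing_At: "(Inl a, \<phi>) \<in> \<Gamma> \<Longrightarrow> typing type \<Gamma> (At a) \<phi>"
| typing_Con: "typing type \<Gamma> (Con C) (type C)"
| typing_Lam: "a \<in> Au \<Longrightarrow> type_env (env_ext \<Gamma> a \<phi>) \<Longrightarrow> typing type (env_ext \<Gamma> a \<phi>) r \<psi> \<Longrightarrow>
    typing type \<Gamma> (Lam a \<phi> r) (\<phi> \<rightarrow>\<^sub>t \<psi>)"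
| typing_App: "typing type \<Gamma> r (\<phi> \<rightarrow>\<^sub>t \<psi>) \<Longrightarrow> typing type \<Gamma> s \<phi> \<Longrightarrow> typing type \<Gamma> (App r s) \<psi>"
| typing_Meta: "distinct_Ad \<sigma> \<Longrightarrow> (Inr X, \<phi>) \<in> \<Gamma> \<Longrightarrow>
    \<forall>(b, s)\<in>set \<sigma>. \<exists>\<psi>. (Inl b, \<psi>) \<in> \<Gamma> \<and> typing type \<Gamma> s \<psi> \<Longrightarrow>
    typing type \<Gamma> (Unk X \<sigma>) \<phi>"


section \<open>Nominal models\<close>

text \<open>
  The elements of all \<open>\<I>\<^sub>\<Gamma>(\<phi>)\<close> are drawn from one type \<open>'d\<close> carrying a permutation action.
  Abstraction and application are total functions on \<open>'d\<close>, constrained only on the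
  arguments for which the model provides them.
\<close>

record ('b, 'c, 'x, 'd) model =
  act :: "atom perm \<Rightarrow> 'd \<Rightarrow> 'd"
  carr :: "('b, 'x) env \<Rightarrow> 'b ty \<Rightarrow> 'd set"
  atom_sem :: "atom \<Rightarrow> 'b ty \<Rightarrow> 'd"
  const_sem :: "'c \<Rightarrow> 'd"
  absn :: "atom \<Rightarrow> 'b ty \<Rightarrow> 'd \<Rightarrow> 'd"
  appl :: "'d \<Rightarrow> 'd \<Rightarrow> 'd"

text \<open>\<open>x[a \<mapsto> y]\<close>, where \<open>\<phi>\<close> is the type at which \<open>a\<close> is abstracted.\<close>

definition subst1 :: "('b, 'c, 'x, 'd) model \<Rightarrow> 'd \<Rightarrow> atom \<Rightarrow> 'b ty \<Rightarrow> 'd \<Rightarrow> 'd" where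
  "subst1 M x a \<phi> y = appl M (absn M a \<phi> x) y"

locale nominal_model =
  fixes type :: "'c \<Rightarrow> 'b ty"
    and M :: "('b, 'c, 'x, 'd) model"
  assumes act_one: "act M 1 x = x"
    and act_mult: "act M (\<pi> * \<pi>') x = act M \<pi> (act M \<pi>' x)"
    and carr_fin_supp: "type_env \<Gamma> \<Longrightarrow> fin_supp (\<lambda>\<pi>. image (act M \<pi>)) (carr M \<Gamma> \<phi>)"
    and atom_closed: "type_env \<Gamma> \<Longrightarrow> (Inl a, \<phi>) \<in> \<Gamma> \<Longrightarrow> atom_sem M a \<phi> \<in> carr M \<Gamma> \<phi>"
    and const_closed: "type_env \<Gamma> \<Longrightarrow> const_sem M C \<in> carr M \<Gamma> (type C)"
    and absn_closed: "type_env \<Gamma> \<Longrightarrow> type_env (env_ext \<Gamma> a \<phi>) \<Longrightarrow>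
      x \<in> carr M (env_ext \<Gamma> a \<phi>) \<psi> \<Longrightarrow> absn M a \<phi> x \<in> carr M \<Gamma> (\<phi> \<rightarrow>\<^sub>t \<psi>)"
    and appl_closed: "type_env \<Gamma> \<Longrightarrow> x \<in> carr M \<Gamma> (\<phi> \<rightarrow>\<^sub>t \<psi>) \<Longrightarrow> y \<in> carr M \<Gamma> \<phi> \<Longrightarrow>
      appl M x y \<in> carr M \<Gamma> \<psi>"
    and carr_Int: "type_env \<Gamma> \<Longrightarrow> type_env \<Gamma>' \<Longrightarrow>
      carr M (\<Gamma> \<inter> \<Gamma>') \<phi> = carr M \<Gamma> \<phi> \<inter> carr M \<Gamma>' \<phi>"
    and elem_supp: "type_env \<Gamma> \<Longrightarrow> x \<in> carr M \<Gamma> \<phi> \<Longrightarrow>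
      fin_supp (act M) x \<and> supp (act M) x \<subseteq> dom_atoms \<Gamma>"
    and carr_atoms_only: "type_env \<Gamma> \<Longrightarrow> type_env \<Gamma>' \<Longrightarrow>
      (\<And>a \<psi>. (Inl a, \<psi>) \<in> \<Gamma> \<longleftrightarrow> (Inl a, \<psi>) \<in> \<Gamma>') \<Longrightarrow> carr M \<Gamma> \<phi> = carr M \<Gamma>' \<phi>"
    and carr_eqvt: "type_env \<Gamma> \<Longrightarrow> act M \<pi> ` carr M \<Gamma> \<phi> = carr M (perm_env \<pi> \<Gamma>) \<phi>"
    and atom_eqvt: "act M \<pi> (atom_sem M a \<phi>) = atom_sem M (\<pi> \<langle>$\<rangle> a) \<phi>"
    and const_eqvt: "act M \<pi> (const_sem M C) = const_sem M C"
    and absn_eqvt: "type_env \<Gamma> \<Longrightarrow> type_env (env_ext \<Gamma> a \<phi>) \<Longrightarrow>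
      x \<in> carr M (env_ext \<Gamma> a \<phi>) \<psi> \<Longrightarrow>
      act M \<pi> (absn M a \<phi> x) = absn M (\<pi> \<langle>$\<rangle> a) \<phi> (act M \<pi> x)"
    and appl_eqvt: "type_env \<Gamma> \<Longrightarrow> x \<in> carr M \<Gamma> (\<phi> \<rightarrow>\<^sub>t \<psi>) \<Longrightarrow> y \<in> carr M \<Gamma> \<phi> \<Longrightarrow>
      act M \<pi> (appl M x y) = appl M (act M \<pi> x) (act M \<pi> y)"
    and subst_atom: "type_env \<Gamma> \<Longrightarrow> x \<in> carr M \<Gamma> \<phi> \<Longrightarrow> subst1 M (atom_sem M a \<phi>) a \<phi> x = x"
    and subst_fresh: "type_env \<Gamma> \<Longrightarrow> z \<in> carr M \<Gamma> \<psi> \<Longrightarrow> x \<in> carr M \<Gamma> \<phi> \<Longrightarrow>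
      a \<notin> supp (act M) z \<Longrightarrow> subst1 M z a \<phi> x = z"
    and subst_appl: "type_env \<Gamma> \<Longrightarrow> type_env (env_ext \<Gamma> a \<phi>) \<Longrightarrow>
      z' \<in> carr M (env_ext \<Gamma> a \<phi>) (\<chi> \<rightarrow>\<^sub>t \<psi>) \<Longrightarrow> z \<in> carr M (env_ext \<Gamma> a \<phi>) \<chi> \<Longrightarrow>
      x \<in> carr M \<Gamma> \<phi> \<Longrightarrow>
      subst1 M (appl M z' z) a \<phi> x = appl M (subst1 M z' a \<phi> x) (subst1 M z a \<phi> x)"
    and subst_absn: "type_env \<Gamma> \<Longrightarrow> type_env (env_ext (env_ext \<Gamma> a \<phi>) c \<chi>) \<Longrightarrow> c \<noteq> a \<Longrightarrow>
      z \<in> carr M (env_ext (env_ext \<Gamma> a \<phi>) c \<chi>) \<psi> \<Longrightarrow> x \<in> carr M \<Gamma> \<phi> \<Longrightarrow>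
      c \<notin> supp (act M) x \<Longrightarrow>
      subst1 M (absn M c \<chi> z) a \<phi> x = absn M c \<chi> (subst1 M z a \<phi> x)"

text \<open>
  Simultaneous substitution \<open>x[b\<^sub>i \<mapsto> y\<^sub>i]\<close>, given by the list of the triples \<open>(b\<^sub>i, \<psi>\<^sub>i, y\<^sub>i)\<close> where
  \<open>\<psi>\<^sub>i\<close> is the type of \<open>b\<^sub>i\<close>. The fresh \<open>c\<^sub>i\<close> are also chosen apart from the \<open>b\<^sub>j\<close>: if
  \<open>c\<^sub>2 = b\<^sub>1\<close>, the permutation would send \<open>b\<^sub>2\<close> to \<open>c\<^sub>1\<close>.
\<close>

definition fresh_atoms ::
  "('b, 'c, 'x, 'd) model \<Rightarrow> 'd \<Rightarrow> (atom \<times> 'b ty \<times> 'd) list \<Rightarrow> atom list \<Rightarrow> bool" where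
  "fresh_atoms M x \<rho> cs \<longleftrightarrow> length cs = length \<rho> \<and> distinct cs \<and>
     set cs \<inter> (supp (act M) x \<union> (\<Union>(b, \<psi>, y)\<in>set \<rho>. insert b (supp (act M) y))) = {}"

definition msubst :: "('b, 'c, 'x, 'd) model \<Rightarrow> 'd \<Rightarrow> (atom \<times> 'b ty \<times> 'd) list \<Rightarrow> 'd" where
  "msubst M x \<rho> =
    (let cs = (SOME cs. fresh_atoms M x \<rho> cs);
         \<pi> = prod_list (map (\<lambda>(c, b, \<psi>, y). \<langle>c \<leftrightarrow> b\<rangle>) (zip cs \<rho>))
     in foldl (\<lambda>z (c, b, \<psi>, y). subst1 M z c \<psi> y) (act M \<pi> x) (zip cs \<rho>))"


section \<open>Valuations and interpretation\<close>

definition valuation :: "('b, 'c, 'x, 'd) model \<Rightarrow> ('x \<Rightarrow> 'd) \<Rightarrow> bool" where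
  "valuation M \<nu> \<longleftrightarrow> (\<forall>X. fin_supp (act M) (\<nu> X) \<and> supp (act M) (\<nu> X) \<subseteq> Ad)"

definition models :: "('b, 'c, 'x, 'd) model \<Rightarrow> ('b, 'x) env \<Rightarrow> ('x \<Rightarrow> 'd) \<Rightarrow> bool" where
  "models M \<Gamma> \<nu> \<longleftrightarrow> (\<forall>X \<phi>. (Inr X, \<phi>) \<in> \<Gamma> \<longrightarrow> \<nu> X \<in> carr M \<Gamma> \<phi>)"

text \<open>
  The clauses defining the interpretation form a relation, because the one for \<open>Lam\<close> depends
  on the choice of a representative with \<open>a \<notin> dom(\<Gamma>)\<close>; \<open>denote\<close> is its unique value.
\<close>

inductive interp ::
  "('b, 'c, 'x, 'd) model \<Rightarrow> ('x \<Rightarrow> 'd) \<Rightarrow> ('b, 'x) env \<Rightarrow> ('b, 'c, 'x) trm \<Rightarrow> 'd \<Rightarrow> bool"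
  for M :: "('b, 'c, 'x, 'd) model" and \<nu> :: "'x \<Rightarrow> 'd" where
  interp_At: "(Inl a, \<phi>) \<in> \<Gamma> \<Longrightarrow> interp M \<nu> \<Gamma> (At a) (atom_sem M a \<phi>)"
| interp_Con: "interp M \<nu> \<Gamma> (Con C) (const_sem M C)"
| interp_Lam: "a \<in> Au - dom_atoms \<Gamma> \<Longrightarrow> interp M \<nu> (env_ext \<Gamma> a \<phi>) r x \<Longrightarrow>
    interp M \<nu> \<Gamma> (Lam a \<phi> r) (absn M a \<phi> x)"
| interp_App: "interp M \<nu> \<Gamma> r x \<Longrightarrow> interp M \<nu> \<Gamma> s y \<Longrightarrow> interp M \<nu> \<Gamma> (App r s) (appl M x y)"
| interp_Unk: "distinct_Ad \<sigma> \<Longrightarrow> (Inr X, \<phi>) \<in> \<Gamma> \<Longrightarrow>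
    list_all2 (\<lambda>p q. fst q = fst p \<and> (Inl (fst p), fst (snd q)) \<in> \<Gamma> \<and>
      interp M \<nu> \<Gamma> (snd p) (snd (snd q))) \<sigma> \<rho> \<Longrightarrow>
    interp M \<nu> \<Gamma> (Unk X \<sigma>) (msubst M (\<nu> X) \<rho>)"

definition denote ::
  "('b, 'c, 'x, 'd) model \<Rightarrow> ('x \<Rightarrow> 'd) \<Rightarrow> ('b, 'x) env \<Rightarrow> ('b, 'c, 'x) trm \<Rightarrow> 'd" where
  "denote M \<nu> \<Gamma> r = (THE x. interp M \<nu> \<Gamma> r x)"

end

theory Submission
  imports Defs
begin

text \<open>
  By induction on the typing derivation, a typed term \<open>r\<close> has an element \<open>x \<in> \<I>\<^sub>\<Gamma>(\<phi>)\<close> such that for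
  every \<open>\<pi>\<close> fixing the atoms in \<open>Ad\<close> and every environment \<open>\<Delta> \<supseteq> \<pi> \<cdot> \<Gamma>\<close>, the element \<open>\<pi> \<cdot> x\<close> is the
  unique interpretation of \<open>\<pi> \<cdot> r\<close> in \<open>\<Delta>\<close>. Existence, uniqueness, weakening and equivariance have to
  go together: a binder may already be declared in \<open>\<Gamma>\<close> and must then be renamed, and two
  representatives of the same abstraction have bodies that differ by such a \<open>\<pi>\<close>. Valuations have
  support in \<open>Ad\<close>, so \<open>\<pi>\<close> fixes the values of the unknowns.

  For the unknowns, an element of \<open>\<I>\<^sub>\<Gamma>(\<phi>)\<close> stays in the carrier when atoms outside its support are
  dropped from \<open>\<Gamma>\<close>. Hence \<open>\<Gamma>\<close> may be assumed not to declare the fresh \<open>c\<^sub>i\<close>, and simultaneous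
  substitution is a sequence of well-typed single ones whose value lies in an environment without the
  \<open>c\<^sub>i\<close>; so it does not depend on their choice, and is equivariant.
\<close>

section \<open>Permutations and least supports\<close>

lemma infinite_Au: "infinite Au"
  unfolding Au_def by (auto dest!: finite_imageD simp: inj_def)

lemma Ad_Au: "a \<in> Ad \<longleftrightarrow> a \<notin> Au"
  unfolding Ad_def Au_def by (cases a) auto

lemma fresh_Au:
  assumes "finite S"
  obtains c where "c \<in> Au" "c \<notin> S"
  using infinite_Au assms by (meson finite_subset subsetI)

lemma fresh_list:
  assumes "finite S"
  shows "\<exists>cs :: atom list. length cs = n \<and> distinct cs \<and> set cs \<inter> S = {}"
proof (induction n)
  case (Suc n)
  then obtain cs where cs: "length cs = n" "distinct cs" "set cs \<inter> S = {}"
    by blast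
  from assms have "finite (S \<union> set cs)"
    by simp
  then obtain c where "c \<notin> S \<union> set cs"
    by (rule fresh_Au)
  then have "length (c # cs) = Suc n \<and> distinct (c # cs) \<and> set (c # cs) \<inter> S = {}"
    using cs by auto
  then show ?case
    by blast
qed simp

text \<open>\<open>\<theta> a\<close> is corrected to \<open>a'\<close> by a swapping that disturbs none of the earlier images.\<close>

lemma perm_maps_lists:
  assumes "length cs = length cs'" "distinct cs" "distinct cs'"
  shows "\<exists>\<theta>. map (apply \<theta>) cs = cs' \<and> (\<forall>a. a \<notin> set cs \<union> set cs' \<longrightarrow> \<theta> \<langle>$\<rangle> a = a)"
  using assms
proof (induction cs cs' rule: list_induct2)
  case Nil
  then show ?case
    by (intro exI[of _ 1]) simp
next
  case (Cons c cs c' cs')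
  then obtain \<theta> where \<theta>: "map (apply \<theta>) cs = cs'"
    "\<And>a. a \<notin> set cs \<union> set cs' \<Longrightarrow> \<theta> \<langle>$\<rangle> a = a"
    by auto
  let ?\<theta> = "\<langle>\<theta> \<langle>$\<rangle> c \<leftrightarrow> c'\<rangle> * \<theta>"
  have "?\<theta> \<langle>$\<rangle> e = \<theta> \<langle>$\<rangle> e" if "e \<in> set cs" for e
  proof -
    have "\<theta> \<langle>$\<rangle> e \<in> set cs'"
      using \<theta>(1) that by auto
    then have "\<theta> \<langle>$\<rangle> e \<noteq> c'" "\<theta> \<langle>$\<rangle> e \<noteq> \<theta> \<langle>$\<rangle> c"
      using Cons.prems that by (auto simp: apply_inj)
    then show ?thesis
      by (simp add: apply_times)
  qed
  then have maps: "map (apply ?\<theta>) (c # cs) = c' # cs'"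
    using \<theta>(1) by (auto simp: apply_times)
  have fixes_rest: "?\<theta> \<langle>$\<rangle> a = a" if "a \<notin> set (c # cs) \<union> set (c' # cs')" for a
  proof -
    have "\<theta> \<langle>$\<rangle> a = a"
      using that \<theta>(2) by simp
    moreover have "a \<noteq> \<theta> \<langle>$\<rangle> c"
      using that \<open>\<theta> \<langle>$\<rangle> a = a\<close> by (metis UnI1 apply_inj list.set_intros(1))
    ultimately show ?thesis
      using that by (simp add: apply_times)
  qed
  show ?case
    by (rule exI[of _ "?\<theta>"], rule conjI, rule maps, intro allI impI, rule fixes_rest)
qed

section \<open>Least supports under an abstract permutation action\<close>

locale perm_action =
  fixes act :: "atom perm \<Rightarrow> 'd \<Rightarrow> 'd"
  assumes one: "act 1 x = x"
    and mult: "act (\<pi> * \<pi>') x = act \<pi> (act \<pi>' x)"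
begin

lemma inverse_right [simp]: "act \<pi> (act (inverse \<pi>) x) = x"
  by (simp flip: mult add: one perm.right_inverse)

text \<open>A renaming of \<open>A - B\<close> away from \<open>\<pi>\<close> fixes \<open>B\<close>, hence \<open>x\<close>, and conjugates \<open>\<pi>\<close> into a
  permutation that fixes \<open>A\<close>.\<close>

lemma supports_Int:
  assumes "finite A" "finite B" "supports act A x" "supports act B x"
  shows "supports act (A \<inter> B) x"
  unfolding supports_def
proof (intro allI impI)
  fix \<pi> :: "atom perm"
  assume \<pi>: "\<forall>a\<in>A \<inter> B. \<pi> \<langle>$\<rangle> a = a"
  obtain as where as: "set as = A - B" "distinct as"
    using finite_distinct_list[of "A - B"] assms(1) by auto
  obtain ds where ds: "length ds = length as" "distinct ds" "set ds \<inter> (A \<union> B \<union> affected \<pi>) = {}"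
    using fresh_list[of "A \<union> B \<union> affected \<pi>" "length as"] assms(1,2) by auto
  obtain \<theta> where \<theta>: "map (apply \<theta>) as = ds"
    "\<And>a. a \<notin> set as \<union> set ds \<Longrightarrow> \<theta> \<langle>$\<rangle> a = a"
    using perm_maps_lists[of as ds] as ds by auto
  have fix_x: "act \<theta> x = x"
    using assms(4) \<theta>(2) as(1) ds(3) unfolding supports_def by (metis DiffD2 IntI UnCI UnE empty_iff)
  have "(inverse \<theta> * \<pi> * \<theta>) \<langle>$\<rangle> a = a" if "a \<in> A" for a
  proof -
    have "\<pi> \<langle>$\<rangle> (\<theta> \<langle>$\<rangle> a) = \<theta> \<langle>$\<rangle> a"
    proof (cases "a \<in> B")
      case True
      then have "\<theta> \<langle>$\<rangle> a = a"
        using \<theta>(2) as(1) ds(3) by auto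
      then show ?thesis
        using True \<pi> that by simp
    next
      case False
      then have "\<theta> \<langle>$\<rangle> a \<in> set ds"
        using \<theta>(1) as(1) that by auto
      then show ?thesis
        using ds(3) by (auto simp: in_affected)
    qed
    then show ?thesis
      by (simp add: apply_times mult.assoc) (simp add: apply_sequence perm.left_inverse)
  qed
  then have "act (inverse \<theta> * \<pi> * \<theta>) x = x"
    using assms(3) unfolding supports_def by blast
  then show "act \<pi> x = x"
    using fix_x by (metis inverse_right mult)
qed

text \<open>A support of least cardinality cannot shrink when intersected with another one, and
  \<open>supports_Int\<close> makes the intersection a support; so it lies inside every finite
  support and \<open>LEAST\<close> in \<open>supp\<close> is attained.\<close>

lemma
  assumes "fin_supp act x"
  shows finite_supp: "finite (supp act x)"
    and supports_supp: "supports act (supp act x) x"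
    and supp_least: "finite B \<Longrightarrow> supports act B x \<Longrightarrow> supp act x \<subseteq> B"
proof -
  let ?P = "\<lambda>A. finite A \<and> supports act A x"
  obtain A where A: "?P A" "\<And>B. ?P B \<Longrightarrow> card A \<le> card B"
    using assms exists_least_iff[of "\<lambda>n. \<exists>A. ?P A \<and> card A = n"]
    unfolding fin_supp_def by (metis not_le)
  have least: "A \<subseteq> B" if "?P B" for B
  proof -
    have "?P (A \<inter> B)"
      using A(1) that supports_Int by auto
    then have "A \<inter> B = A"
      using A by (intro card_seteq) auto
    then show ?thesis
      by blast
  qed
  have "supp act x = A"
    unfolding supp_def by (rule Least_equality) (use A(1) least in auto)
  then show "finite (supp act x)" "supports act (supp act x) x"
    "finite B \<Longrightarrow> supports act B x \<Longrightarrow> supp act x \<subseteq> B"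
    using A(1) least by auto
qed

lemma fixed_if_supp:
  assumes "fin_supp act x" "\<And>a. a \<in> supp act x \<Longrightarrow> \<pi> \<langle>$\<rangle> a = a"
  shows "act \<pi> x = x"
  using supports_supp[OF assms(1)] assms(2) unfolding supports_def by blast

text \<open>If \<open>\<rho>\<close> fixes the image of the support, its conjugate by
  \<open>\<pi>\<close> fixes the support itself, hence \<open>x\<close>. Freshness arguments only
  require this inclusion.\<close>

lemma
  assumes "fin_supp act x"
  shows fin_supp_act: "fin_supp act (act \<pi> x)"
    and supp_act: "supp act (act \<pi> x) \<subseteq> apply \<pi> ` supp act x"
proof -
  let ?A = "apply \<pi> ` supp act x"
  have fin: "finite ?A"
    using finite_supp[OF assms] by simp
  have sup: "supports act ?A (act \<pi> x)"
    unfolding supports_def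
  proof (intro allI impI)
    fix \<rho> :: "atom perm"
    assume \<rho>: "\<forall>a\<in>?A. \<rho> \<langle>$\<rangle> a = a"
    have "act (inverse \<pi> * \<rho> * \<pi>) x = x"
      using assms
    proof (rule fixed_if_supp)
      fix a assume "a \<in> supp act x"
      then have "\<rho> \<langle>$\<rangle> (\<pi> \<langle>$\<rangle> a) = \<pi> \<langle>$\<rangle> a"
        using \<rho> by blast
      then show "(inverse \<pi> * \<rho> * \<pi>) \<langle>$\<rangle> a = a"
        by (simp add: apply_times mult.assoc) (simp add: apply_sequence perm.left_inverse)
    qed
    then show "act \<rho> (act \<pi> x) = act \<pi> x"
      by (metis inverse_right mult)
  qed
  show fs: "fin_supp act (act \<pi> x)"
    using fin sup unfolding fin_supp_def by blast
  show "supp act (act \<pi> x) \<subseteq> ?A"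
    by (rule supp_least[OF fs fin sup])
qed

end

section \<open>Renaming binders\<close>

text \<open>These permutations preserve the split between \<open>Ad\<close> and \<open>Au\<close>,
  so they keep raw terms in the grammar and leave the atoms \<open>b\<close> of an unknown in place,
  while still moving binders freely.\<close>

definition fixes_Ad :: "atom perm \<Rightarrow> bool" where
  "fixes_Ad \<pi> \<longleftrightarrow> (\<forall>a\<in>Ad. \<pi> \<langle>$\<rangle> a = a)"

lemma fixes_Ad_apply: "fixes_Ad \<pi> \<Longrightarrow> a \<in> Ad \<Longrightarrow> \<pi> \<langle>$\<rangle> a = a"
  unfolding fixes_Ad_def by blast

lemma fixes_Ad_one [simp]: "fixes_Ad 1"
  unfolding fixes_Ad_def by simp

lemma fixes_Ad_times: "fixes_Ad \<pi> \<Longrightarrow> fixes_Ad \<rho> \<Longrightarrow> fixes_Ad (\<pi> * \<rho>)"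
  unfolding fixes_Ad_def by (simp add: apply_times)

lemma fixes_Ad_swap: "a \<in> Au \<Longrightarrow> b \<in> Au \<Longrightarrow> fixes_Ad \<langle>a \<leftrightarrow> b\<rangle>"
  unfolding fixes_Ad_def by (metis Ad_Au apply_swap_same)

lemma fixes_Ad_in_Au: "fixes_Ad \<pi> \<Longrightarrow> \<pi> \<langle>$\<rangle> a \<in> Au \<longleftrightarrow> a \<in> Au"
  unfolding fixes_Ad_def by (metis Ad_Au apply_inj)

text \<open>The usual conjugation law for transpositions, stated without inverses so that it can be
  used to move \<open>\<pi>\<close> past a swap.\<close>

lemma swap_conjugate: "\<langle>\<pi> \<langle>$\<rangle> c \<leftrightarrow> \<pi> \<langle>$\<rangle> a\<rangle> * \<pi> = \<pi> * \<langle>c \<leftrightarrow> a\<rangle>"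
proof (rule perm_eqI)
  fix e
  show "(\<langle>\<pi> \<langle>$\<rangle> c \<leftrightarrow> \<pi> \<langle>$\<rangle> a\<rangle> * \<pi>) \<langle>$\<rangle> e = (\<pi> * \<langle>c \<leftrightarrow> a\<rangle>) \<langle>$\<rangle> e"
    by (cases "e = a"; cases "e = c") (simp_all add: apply_times apply_inj)
qed

section \<open>Alpha-equivalence of raw terms under renaming\<close>

lemma map_raw_times:
  "map_raw (apply (\<pi> * \<rho>)) r = map_raw (apply \<pi>) (map_raw (apply \<rho>) r)"
  by (simp add: raw.map_comp apply_times)

lemma finite_set_raw: "finite (set_raw r)"
proof (induction r)
  case (RUnk X \<sigma>)
  then show ?case
    by (auto intro!: finite_UN_I elim: fsts.cases snds.cases)
qed auto

text \<open>Reflexivity is generalised over renamings because \<open>alpha_Lam\<close> compares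
  swapped bodies, to which a plain structural induction hypothesis would not apply.\<close>

lemma alpha_refl_map: "alpha (map_raw f r) (map_raw f r)"
proof (induction r arbitrary: f)
  case (RUnk X \<sigma>)
  then show ?case
    by (auto simp: list_all2_same rel_prod_sel list.rel_map intro!: alpha.intros)
next
  case (RLam a \<phi> r)
  then show ?case
    by (auto simp: raw.map_comp intro!: alpha_Lam[of "{}"])
qed (auto intro: alpha.intros)

lemma alpha_refl: "alpha r r"
  using alpha_refl_map[of id r] by (simp add: raw.map_id)

lemma alpha_map_raw:
  assumes "alpha r s" "fixes_Ad \<pi>"
  shows "alpha (map_raw (apply \<pi>) r) (map_raw (apply \<pi>) s)"
  using assms(1)
proof (induction rule: alpha.induct)
  case (alpha_Unk \<sigma> \<tau> X)
  then have "list_all2 (rel_prod (=) alpha) (map (map_prod (apply \<pi>) (map_raw (apply \<pi>))) \<sigma>)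
    (map (map_prod (apply \<pi>) (map_raw (apply \<pi>))) \<tau>)"
    by (auto simp: list_all2_conv_all_nth rel_prod_sel)
  then show ?case
    by (simp add: alpha.alpha_Unk)
next
  case (alpha_Lam L a r b s \<phi>)
  have "alpha (map_raw (apply \<langle>c \<leftrightarrow> \<pi> \<langle>$\<rangle> a\<rangle>) (map_raw (apply \<pi>) r))
      (map_raw (apply \<langle>c \<leftrightarrow> \<pi> \<langle>$\<rangle> b\<rangle>) (map_raw (apply \<pi>) s))"
    if c: "c \<in> Au - apply \<pi> ` L" for c
  proof -
    \<comment> \<open>Pulling \<open>c\<close> back along \<open>\<pi>\<close> gives an atom of
      \<open>Au - L\<close>; conjugation then reduces the goal to \<open>\<pi>\<close> applied to
      the induction hypothesis for \<open>d\<close>. The finite exception set is thus carried along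
      to its image under \<open>\<pi>\<close>.\<close>
    obtain d where d: "c = \<pi> \<langle>$\<rangle> d"
      using bij_apply[of \<pi>] by (metis bij_pointE)
    then have "d \<in> Au - L"
      using c assms(2) by (auto simp: fixes_Ad_in_Au)
    then show ?thesis
      using alpha_Lam.IH unfolding d by (simp flip: map_raw_times add: swap_conjugate)
  qed
  then show ?case
    using alpha_Lam.hyps by (auto intro!: alpha.alpha_Lam[of "apply \<pi> ` L"])
qed (auto intro: alpha.intros)

lemma alpha_RLam:
  assumes "alpha r s" "a \<in> Au"
  shows "alpha (RLam a \<phi> r) (RLam a \<phi> s)"
  by (rule alpha_Lam[of "{}"]) (use assms in \<open>auto intro: alpha_map_raw fixes_Ad_swap\<close>)

text \<open>Swapping \<open>a\<close> to \<open>c\<close> and then \<open>c\<close> to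
  \<open>d\<close> acts like swapping \<open>a\<close> to \<open>d\<close> on all atoms other than
  \<open>c\<close> and \<open>d\<close>, and neither of these occurs in \<open>r\<close>.\<close>

lemma alpha_rename:
  assumes "c \<notin> set_raw r"
  shows "alpha (RLam c \<phi> (map_raw (apply \<langle>c \<leftrightarrow> a\<rangle>) r)) (RLam a \<phi> r)"
proof (rule alpha_Lam[of "insert a (set_raw r)"])
  show "\<forall>d\<in>Au - insert a (set_raw r).
    alpha (map_raw (apply \<langle>d \<leftrightarrow> c\<rangle>) (map_raw (apply \<langle>c \<leftrightarrow> a\<rangle>) r)) (map_raw (apply \<langle>d \<leftrightarrow> a\<rangle>) r)"
  proof
    fix d assume d: "d \<in> Au - insert a (set_raw r)"
    have "\<langle>d \<leftrightarrow> c\<rangle> \<langle>$\<rangle> (\<langle>c \<leftrightarrow> a\<rangle> \<langle>$\<rangle> e) = \<langle>d \<leftrightarrow> a\<rangle> \<langle>$\<rangle> e" if "e \<in> set_raw r" for e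
    proof -
      have "e \<noteq> c" "e \<noteq> d"
        using that d assms by auto
      then show ?thesis
        by (cases "e = a") simp_all
    qed
    then have "map_raw (apply \<langle>d \<leftrightarrow> c\<rangle>) (map_raw (apply \<langle>c \<leftrightarrow> a\<rangle>) r) = map_raw (apply \<langle>d \<leftrightarrow> a\<rangle>) r"
      by (auto simp: raw.map_comp intro!: raw.map_cong)
    then show "alpha (map_raw (apply \<langle>d \<leftrightarrow> c\<rangle>) (map_raw (apply \<langle>c \<leftrightarrow> a\<rangle>) r)) (map_raw (apply \<langle>d \<leftrightarrow> a\<rangle>) r)"
      by (simp add: alpha_refl)
  qed
qed (simp add: finite_set_raw)

lemma grammar_map_raw:
  assumes "grammar r" "fixes_Ad \<pi>"
  shows "grammar (map_raw (apply \<pi>) r)"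
  using assms(1)
proof (induction rule: grammar.induct)
  case (3 \<sigma> X)
  have eq: "map fst (map (map_prod (apply \<pi>) (map_raw (apply \<pi>))) \<sigma>) = map fst \<sigma>"
    using 3(1) assms(2) by (auto simp: fixes_Ad_apply)
  have "distinct_Ad (map (map_prod (apply \<pi>) (map_raw (apply \<pi>))) \<sigma>)"
    using 3(1) eq by (metis list.set_map)
  moreover have "\<forall>p\<in>set (map (map_prod (apply \<pi>) (map_raw (apply \<pi>))) \<sigma>). grammar (snd p)"
    using 3(2) by auto
  ultimately show ?case
    unfolding raw.map by (rule grammar.intros)
qed (use assms(2) in \<open>auto intro!: grammar.intros simp: fixes_Ad_in_Au\<close>)

section \<open>Constructors on alpha-equivalence classes\<close>

lemma grammar_rep_trm: "grammar (rep_trm t)"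
  using Quotient3_rep_reflp[OF Quotient3_trm] by blast

lemma abs_rep_trm: "abs_trm (rep_trm t) = t"
  by (rule Quotient3_abs_rep[OF Quotient3_trm])

lemma abs_trm_eq_iff: "grammar r \<Longrightarrow> grammar s \<Longrightarrow> abs_trm r = abs_trm s \<longleftrightarrow> alpha r s"
  using Quotient3_rel[OF Quotient3_trm, of r s] alpha_refl by blast

lemma alpha_rep_trm_iff: "alpha (rep_trm s) (rep_trm t) \<longleftrightarrow> s = t"
  using abs_trm_eq_iff[OF grammar_rep_trm grammar_rep_trm, of s t] by (simp add: abs_rep_trm)

lemma alpha_rep_abs: "grammar r \<Longrightarrow> alpha (rep_trm (abs_trm r)) r"
  using abs_trm_eq_iff[OF grammar_rep_trm, of r "abs_trm r"] by (simp add: abs_rep_trm)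

lemma grammar_RUnk_rep:
  "distinct_Ad \<sigma> \<Longrightarrow> grammar (RUnk X (map (map_prod id rep_trm) \<sigma>))"
  by (force intro!: grammar.intros simp: grammar_rep_trm)

text \<open>The quotient is partial, so \<open>abs_trm_eq_iff\<close> asks for membership in the
  grammar on both sides; these facts supply it for every constructor.\<close>

lemmas trm_grammar = grammar.intros(1,2,4,5) grammar_RUnk_rep grammar_rep_trm

text \<open>Alpha-equivalent raw terms have the same head constructor. The side conditions on
  \<open>Lam\<close> and \<open>Unk\<close> keep their raw terms in the grammar, outside which the
  class is unspecified.\<close>

lemma trm_distinct:
  "At a \<noteq> Con C" "At a \<noteq> App r s"
  "Con C \<noteq> App r s"
  "d \<in> Au \<Longrightarrow> At a \<noteq> Lam d \<phi> r" "d \<in> Au \<Longrightarrow> Con C \<noteq> Lam d \<phi> r" "d \<in> Au \<Longrightarrow> App r' s \<noteq> Lam d \<phi> r"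
  "distinct_Ad \<sigma> \<Longrightarrow> At a \<noteq> Unk X \<sigma>" "distinct_Ad \<sigma> \<Longrightarrow> Con C \<noteq> Unk X \<sigma>"
  "distinct_Ad \<sigma> \<Longrightarrow> App r s \<noteq> Unk X \<sigma>" "d \<in> Au \<Longrightarrow> distinct_Ad \<sigma> \<Longrightarrow> Lam d \<phi> r \<noteq> Unk X \<sigma>"
  unfolding At_def Con_def App_def Lam_def Unk_def
  by (auto simp: abs_trm_eq_iff trm_grammar elim: alpha_elims)

lemma At_inj: "At a = At b \<Longrightarrow> a = b"
  unfolding At_def by (auto simp: abs_trm_eq_iff trm_grammar elim: alpha_elims)

lemma Con_inj: "Con C = Con D \<Longrightarrow> C = D"
  unfolding Con_def by (auto simp: abs_trm_eq_iff trm_grammar elim: alpha_elims)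

lemma App_inj: "App r s = App r' s' \<Longrightarrow> r = r' \<and> s = s'"
  unfolding App_def
  by (auto simp: abs_trm_eq_iff trm_grammar alpha_rep_trm_iff elim: alpha_elims)

text \<open>Nothing is bound in the list, so alpha-equivalence is componentwise, and on chosen
  representatives it is equality of the classes.\<close>

lemma Unk_inj:
  assumes "distinct_Ad \<sigma>" "distinct_Ad \<tau>" "Unk X \<sigma> = Unk Y \<tau>"
  shows "X = Y \<and> \<sigma> = \<tau>"
proof -
  have "alpha (RUnk X (map (map_prod id rep_trm) \<sigma>)) (RUnk Y (map (map_prod id rep_trm) \<tau>))"
    using assms unfolding Unk_def by (simp add: abs_trm_eq_iff trm_grammar)
  then have "X = Y" and "list_all2 (\<lambda>p q. fst p = fst q \<and> snd p = snd q) \<sigma> \<tau>"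
    by (auto elim!: alpha_elims simp: list.rel_map rel_prod_sel alpha_rep_trm_iff)
  then show ?thesis
    by (simp flip: prod_eq_iff add: list.rel_eq)
qed

section \<open>Renaming of terms\<close>

definition perm_trm :: "atom perm \<Rightarrow> ('b, 'c, 'x) trm \<Rightarrow> ('b, 'c, 'x) trm" where
  "perm_trm \<pi> t = abs_trm (map_raw (apply \<pi>) (rep_trm t))"

text \<open>Such a renaming respects the grammar and alpha-equivalence, so the representative picked
  in \<open>perm_trm\<close> is immaterial.\<close>

lemma perm_trm_abs:
  assumes "fixes_Ad \<pi>" "grammar r"
  shows "perm_trm \<pi> (abs_trm r) = abs_trm (map_raw (apply \<pi>) r)"
  unfolding perm_trm_def
  by (simp add: assms abs_trm_eq_iff grammar_map_raw grammar_rep_trm alpha_map_raw alpha_rep_abs)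

lemma alpha_rep_perm:
  "fixes_Ad \<pi> \<Longrightarrow> alpha (rep_trm (perm_trm \<pi> t)) (map_raw (apply \<pi>) (rep_trm t))"
  unfolding perm_trm_def by (simp add: alpha_rep_abs grammar_map_raw grammar_rep_trm)

lemma perm_trm_one: "perm_trm 1 t = t"
  unfolding perm_trm_def by (simp add: raw.map_id abs_rep_trm)

lemma perm_trm_times:
  "fixes_Ad \<pi> \<Longrightarrow> fixes_Ad \<rho> \<Longrightarrow> perm_trm (\<pi> * \<rho>) t = perm_trm \<pi> (perm_trm \<rho> t)"
  by (simp add: perm_trm_def[of \<rho>] perm_trm_def[of "\<pi> * \<rho>"] perm_trm_abs grammar_map_raw
      grammar_rep_trm map_raw_times)

lemma perm_trm_At: "fixes_Ad \<pi> \<Longrightarrow> perm_trm \<pi> (At a) = At (\<pi> \<langle>$\<rangle> a)"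
  unfolding At_def by (simp add: perm_trm_abs trm_grammar)

lemma perm_trm_Con: "fixes_Ad \<pi> \<Longrightarrow> perm_trm \<pi> (Con C) = Con C"
  unfolding Con_def by (simp add: perm_trm_abs trm_grammar)

lemma perm_trm_App: "fixes_Ad \<pi> \<Longrightarrow> perm_trm \<pi> (App r s) = App (perm_trm \<pi> r) (perm_trm \<pi> s)"
  unfolding App_def
  by (auto simp: perm_trm_abs trm_grammar abs_trm_eq_iff grammar_map_raw
      intro!: alpha.intros alpha_sym[OF alpha_rep_perm])

lemma perm_trm_Lam:
  "fixes_Ad \<pi> \<Longrightarrow> a \<in> Au \<Longrightarrow> perm_trm \<pi> (Lam a \<phi> r) = Lam (\<pi> \<langle>$\<rangle> a) \<phi> (perm_trm \<pi> r)"
  unfolding Lam_def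
  by (auto simp: perm_trm_abs trm_grammar abs_trm_eq_iff grammar_map_raw fixes_Ad_in_Au
      intro!: alpha_RLam alpha_sym[OF alpha_rep_perm])

text \<open>The substituted atoms lie in \<open>Ad\<close>, so \<open>\<pi>\<close> acts on the
  arguments only.\<close>

lemma perm_trm_Unk:
  assumes "fixes_Ad \<pi>" "distinct_Ad \<sigma>"
  shows "perm_trm \<pi> (Unk X \<sigma>) = Unk X (map (map_prod id (perm_trm \<pi>)) \<sigma>)"
proof -
  have "distinct_Ad (map (map_prod id (perm_trm \<pi>)) \<sigma>)"
    using assms(2) by (auto simp: image_comp)
  note gr = trm_grammar(5)[OF assms(2), of X] trm_grammar(5)[OF this, of X]
  have "\<pi> \<langle>$\<rangle> (fst p) = fst p" if "p \<in> set \<sigma>" for p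
    using assms that by (auto intro: fixes_Ad_apply)
  then have "alpha (map_raw (apply \<pi>) (RUnk X (map (map_prod id rep_trm) \<sigma>)))
    (RUnk X (map (map_prod id rep_trm) (map (map_prod id (perm_trm \<pi>)) \<sigma>)))"
    using assms by (auto simp: list.rel_map rel_prod_sel list_all2_same
        intro!: alpha.intros alpha_sym[OF alpha_rep_perm])
  then show ?thesis
    unfolding Unk_def using gr assms(1) grammar_map_raw[OF gr(1) assms(1)]
    by (simp add: perm_trm_abs abs_trm_eq_iff)
qed

text \<open>The cofinite clause of \<open>alpha_Lam\<close>, lifted to classes: it is how two
  representatives of one abstraction are compared below.\<close>

lemma Lam_eqD:
  assumes "a \<in> Au" "b \<in> Au" "Lam a \<phi> r = Lam b \<psi> s"
  shows "\<phi> = \<psi> \<and> (\<exists>L. finite L \<and> (\<forall>c\<in>Au - L. perm_trm \<langle>c \<leftrightarrow> a\<rangle> r = perm_trm \<langle>c \<leftrightarrow> b\<rangle> s))"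
proof -
  have "alpha (RLam a \<phi> (rep_trm r)) (RLam b \<psi> (rep_trm s))"
    using assms unfolding Lam_def by (simp add: abs_trm_eq_iff trm_grammar)
  then obtain L where "\<phi> = \<psi>" "finite L"
    "\<And>c. c \<in> Au - L \<Longrightarrow> alpha (map_raw (apply \<langle>c \<leftrightarrow> a\<rangle>) (rep_trm r)) (map_raw (apply \<langle>c \<leftrightarrow> b\<rangle>) (rep_trm s))"
    by (auto elim!: alpha_elims)
  then show ?thesis
    using assms(1,2)
    by (auto simp: perm_trm_def abs_trm_eq_iff grammar_map_raw grammar_rep_trm fixes_Ad_swap)
qed

text \<open>The exceptions are the finitely many atoms of one raw representative of the body, so a
  binder can always be chosen outside a given finite set.\<close>

lemma Lam_rename:
  assumes "a \<in> Au"
  shows "\<exists>L. finite L \<and> (\<forall>c\<in>Au - L. Lam c \<phi> (perm_trm \<langle>c \<leftrightarrow> a\<rangle> r) = Lam a \<phi> r)"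
proof (intro exI conjI ballI)
  show "finite (set_raw (rep_trm r))"
    by (rule finite_set_raw)
  fix c assume c: "c \<in> Au - set_raw (rep_trm r)"
  have "alpha (RLam c \<phi> (rep_trm (perm_trm \<langle>c \<leftrightarrow> a\<rangle> r))) (RLam c \<phi> (map_raw (apply \<langle>c \<leftrightarrow> a\<rangle>) (rep_trm r)))"
    using c assms by (intro alpha_RLam alpha_rep_perm fixes_Ad_swap) auto
  then have "alpha (RLam c \<phi> (rep_trm (perm_trm \<langle>c \<leftrightarrow> a\<rangle> r))) (RLam a \<phi> (rep_trm r))"
    using alpha_rename alpha_trans c by blast
  then show "Lam c \<phi> (perm_trm \<langle>c \<leftrightarrow> a\<rangle> r) = Lam a \<phi> r"
    using c assms unfolding Lam_def by (simp add: abs_trm_eq_iff trm_grammar)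
qed

section \<open>Simultaneous substitution\<close>

lemma type_env_subset: "type_env \<Gamma> \<Longrightarrow> \<Delta> \<subseteq> \<Gamma> \<Longrightarrow> type_env \<Delta>"
  unfolding type_env_def dom_atoms_def single_valued_def
  by (auto intro: finite_subset[rotated])

lemma type_env_unique: "type_env \<Gamma> \<Longrightarrow> (u, \<phi>) \<in> \<Gamma> \<Longrightarrow> (u, \<psi>) \<in> \<Gamma> \<Longrightarrow> \<phi> = \<psi>"
  unfolding type_env_def by (blast dest: single_valuedD)

lemma finite_dom_atoms: "type_env \<Gamma> \<Longrightarrow> finite (dom_atoms \<Gamma>)"
  unfolding type_env_def by blast

lemma dom_atomsI: "(Inl a, \<phi>) \<in> \<Gamma> \<Longrightarrow> a \<in> dom_atoms \<Gamma>"
  unfolding dom_atoms_def by auto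

lemma dom_atoms_mono: "\<Gamma> \<subseteq> \<Delta> \<Longrightarrow> dom_atoms \<Gamma> \<subseteq> dom_atoms \<Delta>"
  unfolding dom_atoms_def by auto

lemma dom_atoms_env_ext [simp]: "dom_atoms (env_ext \<Gamma> a \<phi>) = insert a (dom_atoms \<Gamma>)"
  unfolding dom_atoms_def by auto

lemma type_env_ext: "type_env \<Gamma> \<Longrightarrow> a \<notin> dom_atoms \<Gamma> \<Longrightarrow> type_env (env_ext \<Gamma> a \<phi>)"
  unfolding type_env_def by (auto simp: single_valued_def intro: dom_atomsI)

lemma perm_env_Inl: "(Inl a, \<phi>) \<in> \<Gamma> \<Longrightarrow> (Inl (\<pi> \<langle>$\<rangle> a), \<phi>) \<in> perm_env \<pi> \<Gamma>"
  unfolding perm_env_def by force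

lemma perm_env_cases:
  assumes "(u, \<phi>) \<in> perm_env \<pi> \<Gamma>"
  obtains (Inl) a where "u = Inl (\<pi> \<langle>$\<rangle> a)" "(Inl a, \<phi>) \<in> \<Gamma>"
  | (Inr) X where "u = Inr X" "(Inr X, \<phi>) \<in> \<Gamma>"
proof -
  obtain v where "u = map_sum (apply \<pi>) id v" "(v, \<phi>) \<in> \<Gamma>"
    using assms unfolding perm_env_def by auto
  then show ?thesis
    using that by (cases v) auto
qed

lemma dom_atoms_perm_env: "dom_atoms (perm_env \<pi> \<Gamma>) = apply \<pi> ` dom_atoms \<Gamma>"
  by (fastforce simp: dom_atoms_def Domain_iff intro: perm_env_Inl elim: perm_env_cases)

lemma perm_env_one [simp]: "perm_env 1 \<Gamma> = \<Gamma>"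
  unfolding perm_env_def by (simp only: apply_one sum.map_id0 prod.map_id0 image_id id_apply)

lemma type_env_perm_env:
  assumes "type_env \<Gamma>"
  shows "type_env (perm_env \<pi> \<Gamma>)"
proof -
  have "single_valued (perm_env \<pi> \<Gamma>)"
    using type_env_unique[OF assms]
    by (auto intro!: single_valuedI elim!: perm_env_cases simp: apply_inj)
  then show ?thesis
    using finite_dom_atoms[OF assms] unfolding type_env_def by (simp add: dom_atoms_perm_env)
qed

definition drop_atoms :: "atom set \<Rightarrow> ('b, 'x) env \<Rightarrow> ('b, 'x) env" where
  "drop_atoms S \<Gamma> = {p \<in> \<Gamma>. fst p \<notin> Inl ` S}"

lemma drop_atoms_subset: "drop_atoms S \<Gamma> \<subseteq> \<Gamma>"
  unfolding drop_atoms_def by blast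

lemma type_env_drop_atoms: "type_env \<Gamma> \<Longrightarrow> type_env (drop_atoms S \<Gamma>)"
  using type_env_subset drop_atoms_subset by blast

lemma dom_drop_atoms: "dom_atoms (drop_atoms S \<Gamma>) = dom_atoms \<Gamma> - S"
  unfolding dom_atoms_def drop_atoms_def by auto

lemma drop_atoms_empty [simp]: "drop_atoms {} \<Gamma> = \<Gamma>"
  unfolding drop_atoms_def by simp

lemma drop_atoms_insert: "drop_atoms (insert c S) \<Gamma> = drop_atoms {c} (drop_atoms S \<Gamma>)"
  unfolding drop_atoms_def by auto

lemma drop_atoms_Inl: "(Inl b, \<psi>) \<in> drop_atoms S \<Gamma> \<longleftrightarrow> (Inl b, \<psi>) \<in> \<Gamma> \<and> b \<notin> S"
  unfolding drop_atoms_def by auto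

text \<open>If \<open>\<Gamma>\<close> already declares \<open>a\<close>, it does so at type
  \<open>\<phi>\<close>; hence \<open>a\<close> can be removed before an abstraction is formed, and
  the body keeps its environment.\<close>

lemma env_ext_drop:
  assumes "type_env (env_ext \<Gamma> a \<phi>)"
  shows "env_ext (drop_atoms {a} \<Gamma>) a \<phi> = env_ext \<Gamma> a \<phi>"
  using type_env_unique[OF assms, of "Inl a"] unfolding drop_atoms_def by auto

text \<open>An entry \<open>(c, b, \<psi>, y)\<close> consists of a fresh atom, the atom it
  replaces, their type and the argument substituted. \<open>binds\<close> declares the fresh atoms
  while the substitution is in progress.\<close>

definition binds :: "(atom \<times> atom \<times> 'b ty \<times> 'd) list \<Rightarrow> ('b, 'x) env" where
  "binds L = (\<lambda>(c, b, \<psi>, y). (Inl c, \<psi>)) ` set L"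

lemma binds_Nil [simp]: "binds [] = {}"
  unfolding binds_def by simp

lemma binds_Cons [simp]: "binds ((c, b, \<psi>, y) # L) = env_ext (binds L) c \<psi>"
  unfolding binds_def by simp

lemma dom_atoms_binds: "dom_atoms (\<Gamma> \<union> binds L) = dom_atoms \<Gamma> \<union> fst ` set L"
  unfolding binds_def dom_atoms_def by force

lemma type_env_binds:
  assumes "type_env \<Gamma>" "distinct (map fst L)" "fst ` set L \<inter> dom_atoms \<Gamma> = {}"
  shows "type_env (\<Gamma> \<union> binds L)"
  using assms
proof (induction L)
  case (Cons p L)
  obtain c b \<psi> y where p: "p = (c, b, \<psi>, y)"
    by (metis prod_cases4)
  show ?case
    using Cons type_env_ext[of "\<Gamma> \<union> binds L" c \<psi>] by (auto simp: p dom_atoms_binds)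
qed simp

definition swaps :: "(atom \<times> atom \<times> 'b ty \<times> 'd) list \<Rightarrow> atom perm" where
  "swaps L = prod_list (map (\<lambda>(c, b, \<psi>, y). \<langle>c \<leftrightarrow> b\<rangle>) L)"

lemma swaps_Nil [simp]: "swaps [] = 1"
  unfolding swaps_def by simp

lemma swaps_Cons [simp]: "swaps ((c, b, \<psi>, y) # L) = \<langle>c \<leftrightarrow> b\<rangle> * swaps L"
  unfolding swaps_def by simp

definition substs :: "('b, 'c, 'x, 'd) model \<Rightarrow> 'd \<Rightarrow> (atom \<times> atom \<times> 'b ty \<times> 'd) list \<Rightarrow> 'd" where
  "substs M = foldl (\<lambda>z (c, b, \<psi>, y). subst1 M z c \<psi> y)"

lemma substs_Nil [simp]: "substs M z [] = z"
  unfolding substs_def by simp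

lemma substs_Cons [simp]: "substs M z ((c, b, \<psi>, y) # L) = substs M (subst1 M z c \<psi> y) L"
  unfolding substs_def by simp

text \<open>Since \<open>msubst\<close> hides a choice of fresh atoms, equivariance is first shown
  with these atoms as a parameter that can be permuted along with the rest.\<close>

definition msubst_with ::
  "('b, 'c, 'x, 'd) model \<Rightarrow> atom list \<Rightarrow> 'd \<Rightarrow> (atom \<times> 'b ty \<times> 'd) list \<Rightarrow> 'd" where
  "msubst_with M cs x \<rho> = substs M (act M (swaps (zip cs \<rho>)) x) (zip cs \<rho>)"

lemma msubst_eq_msubst_with:
  "msubst M x \<rho> = msubst_with M (SOME cs. fresh_atoms M x \<rho> cs) x \<rho>"
  unfolding msubst_def msubst_with_def swaps_def substs_def Let_def ..

definition perm_quad ::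
  "('b, 'c, 'x, 'd) model \<Rightarrow> atom perm \<Rightarrow> atom \<times> atom \<times> 'b ty \<times> 'd \<Rightarrow> atom \<times> atom \<times> 'b ty \<times> 'd" where
  "perm_quad M \<pi> = (\<lambda>(c, b, \<psi>, y). (\<pi> \<langle>$\<rangle> c, \<pi> \<langle>$\<rangle> b, \<psi>, act M \<pi> y))"

lemma perm_quad_simp [simp]:
  "perm_quad M \<pi> (c, b, \<psi>, y) = (\<pi> \<langle>$\<rangle> c, \<pi> \<langle>$\<rangle> b, \<psi>, act M \<pi> y)"
  unfolding perm_quad_def by simp

definition perm_triple ::
  "('b, 'c, 'x, 'd) model \<Rightarrow> atom perm \<Rightarrow> atom \<times> 'b ty \<times> 'd \<Rightarrow> atom \<times> 'b ty \<times> 'd" where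
  "perm_triple M \<pi> = (\<lambda>(b, \<psi>, y). (\<pi> \<langle>$\<rangle> b, \<psi>, act M \<pi> y))"

lemma perm_triple_simp [simp]:
  "perm_triple M \<pi> (b, \<psi>, y) = (\<pi> \<langle>$\<rangle> b, \<psi>, act M \<pi> y)"
  unfolding perm_triple_def by simp

lemma zip_perm:
  "zip (map (apply \<pi>) cs) (map (perm_triple M \<pi>) \<rho>) = map (perm_quad M \<pi>) (zip cs \<rho>)"
  by (auto simp: zip_map_map)

lemma swaps_conjugate: "swaps (map (perm_quad M \<pi>) L) * \<pi> = \<pi> * swaps L"
proof (induction L)
  case (Cons p L)
  obtain c b \<psi> y where p: "p = (c, b, \<psi>, y)"
    by (metis prod_cases4)
  have "swaps (map (perm_quad M \<pi>) (p # L)) * \<pi>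
    = \<langle>\<pi> \<langle>$\<rangle> c \<leftrightarrow> \<pi> \<langle>$\<rangle> b\<rangle> * (swaps (map (perm_quad M \<pi>) L) * \<pi>)"
    by (simp add: p mult.assoc)
  also have "\<dots> = \<langle>\<pi> \<langle>$\<rangle> c \<leftrightarrow> \<pi> \<langle>$\<rangle> b\<rangle> * \<pi> * swaps L"
    by (simp add: Cons mult.assoc)
  also have "\<dots> = \<pi> * swaps (p # L)"
    by (simp only: swap_conjugate) (simp add: p mult.assoc)
  finally show ?case .
qed simp

definition typed_args ::
  "('b, 'c, 'x, 'd) model \<Rightarrow> ('b, 'x) env \<Rightarrow> (atom \<times> 'b ty \<times> 'd) list \<Rightarrow> bool" where
  "typed_args M \<Gamma> \<rho> \<longleftrightarrow> (\<forall>(b, \<psi>, y)\<in>set \<rho>. (Inl b, \<psi>) \<in> \<Gamma> \<and> y \<in> carr M \<Gamma> \<psi>)"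

section \<open>Carriers under weakening, permutation and removal of atoms\<close>

context nominal_model
begin

sublocale act: perm_action "act M"
  by unfold_locales (fact act_one act_mult)+

text \<open>For nested environments the intersection law \<open>carr_Int\<close> is already
  weakening.\<close>

lemma carr_mono: "type_env \<Gamma>' \<Longrightarrow> \<Gamma> \<subseteq> \<Gamma>' \<Longrightarrow> x \<in> carr M \<Gamma> \<phi> \<Longrightarrow> x \<in> carr M \<Gamma>' \<phi>"
  using carr_Int[of \<Gamma> \<Gamma>' \<phi>] by (auto dest: type_env_subset simp: Int_absorb2)

lemma act_carr: "type_env \<Gamma> \<Longrightarrow> x \<in> carr M \<Gamma> \<phi> \<Longrightarrow> act M \<pi> x \<in> carr M (perm_env \<pi> \<Gamma>) \<phi>"
  using carr_eqvt by blast

lemma act_fixed_carr: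
  assumes "type_env \<Gamma>" "x \<in> carr M \<Gamma> \<phi>" "\<And>a. a \<in> dom_atoms \<Gamma> \<Longrightarrow> \<pi> \<langle>$\<rangle> a = a"
  shows "act M \<pi> x = x"
  using elem_supp[OF assms(1,2)] assms(3) act.fixed_if_supp by blast

text \<open>Swapping \<open>c\<close> with an atom outside \<open>\<Gamma>\<close> fixes \<open>x\<close>, which thus lies in the carriers of two
  environments whose intersection omits \<open>c\<close>.\<close>

lemma carr_drop_atom:
  assumes "type_env \<Gamma>" "x \<in> carr M \<Gamma> \<phi>" "c \<notin> supp (act M) x"
  shows "x \<in> carr M (drop_atoms {c} \<Gamma>) \<phi>"
proof -
  obtain d where d: "d \<notin> insert c (dom_atoms \<Gamma>)"
    using fresh_Au[of "insert c (dom_atoms \<Gamma>)"] finite_dom_atoms[OF assms(1)] by auto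
  let ?\<tau> = "\<langle>c \<leftrightarrow> d\<rangle>"
  have supp: "fin_supp (act M) x" "supp (act M) x \<subseteq> dom_atoms \<Gamma>"
    using elem_supp[OF assms(1,2)] by auto
  have "act M ?\<tau> x = x"
    using supp(1)
  proof (rule act.fixed_if_supp)
    fix a assume "a \<in> supp (act M) x"
    then have "a \<noteq> c" "a \<noteq> d"
      using assms(3) supp(2) d by auto
    then show "?\<tau> \<langle>$\<rangle> a = a"
      by simp
  qed
  then have "x \<in> carr M (perm_env ?\<tau> \<Gamma>) \<phi>"
    using act_carr[OF assms(1,2), of ?\<tau>] by simp
  then have "x \<in> carr M (\<Gamma> \<inter> perm_env ?\<tau> \<Gamma>) \<phi>"
    using carr_Int[OF assms(1) type_env_perm_env[OF assms(1)]] assms(2) by blast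
  moreover have "\<Gamma> \<inter> perm_env ?\<tau> \<Gamma> \<subseteq> drop_atoms {c} \<Gamma>"
  proof -
    have "c \<notin> dom_atoms (perm_env ?\<tau> \<Gamma>)"
      using d by (auto simp: dom_atoms_perm_env dest: sym)
    then show ?thesis
      unfolding drop_atoms_def by (auto dest: dom_atomsI)
  qed
  ultimately show ?thesis
    using carr_mono type_env_drop_atoms[OF assms(1)] by blast
qed

lemma carr_drop_atoms:
  assumes "finite S" "type_env \<Gamma>" "x \<in> carr M \<Gamma> \<phi>" "S \<inter> supp (act M) x = {}"
  shows "x \<in> carr M (drop_atoms S \<Gamma>) \<phi>"
  using assms(1,4)
proof (induction S)
  case empty
  then show ?case
    by (simp add: assms)
next
  case (insert c S)
  then show ?case
    unfolding drop_atoms_insert[of c S]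
    by (intro carr_drop_atom type_env_drop_atoms assms) auto
qed

section \<open>Closure and equivariance of substitution\<close>

lemma subst1_closed:
  assumes "type_env \<Gamma>" "type_env (env_ext \<Gamma> c \<psi>)" "z \<in> carr M (env_ext \<Gamma> c \<psi>) \<phi>" "y \<in> carr M \<Gamma> \<psi>"
  shows "subst1 M z c \<psi> y \<in> carr M \<Gamma> \<phi>"
  unfolding subst1_def using assms by (blast intro: appl_closed absn_closed)

lemma subst1_eqvt:
  assumes "type_env \<Gamma>" "type_env (env_ext \<Gamma> c \<psi>)" "z \<in> carr M (env_ext \<Gamma> c \<psi>) \<phi>" "y \<in> carr M \<Gamma> \<psi>"
  shows "act M \<pi> (subst1 M z c \<psi> y) = subst1 M (act M \<pi> z) (\<pi> \<langle>$\<rangle> c) \<psi> (act M \<pi> y)"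
  unfolding subst1_def using appl_eqvt[OF assms(1) absn_closed[OF assms(1-3)] assms(4)]
  by (simp add: absn_eqvt[OF assms(1-3)])

text \<open>Each substitution removes one fresh atom from the environment, until only
  \<open>\<Gamma>\<close> is left. Closure and equivariance are proved together because the
  equivariance of a single substitution requires typed operands.\<close>

lemma substs_closed_eqvt:
  assumes "type_env \<Gamma>" "distinct (map fst L)" "fst ` set L \<inter> dom_atoms \<Gamma> = {}"
    and "\<forall>(c, b, \<psi>, y)\<in>set L. y \<in> carr M \<Gamma> \<psi>" "z \<in> carr M (\<Gamma> \<union> binds L) \<phi>"
  shows "substs M z L \<in> carr M \<Gamma> \<phi>
    \<and> act M \<pi> (substs M z L) = substs M (act M \<pi> z) (map (perm_quad M \<pi>) L)"
  using assms(2-)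
proof (induction L arbitrary: z)
  case (Cons p L)
  obtain c b \<psi> y where p: "p = (c, b, \<psi>, y)"
    by (metis prod_cases4)
  have te: "type_env (\<Gamma> \<union> binds L)"
    using Cons.prems assms(1) by (intro type_env_binds) auto
  moreover have ext: "type_env (env_ext (\<Gamma> \<union> binds L) c \<psi>)"
    using Cons.prems by (intro type_env_ext te) (auto simp: p dom_atoms_binds)
  moreover have z: "z \<in> carr M (env_ext (\<Gamma> \<union> binds L) c \<psi>) \<phi>"
    using Cons.prems by (simp add: p)
  moreover have y: "y \<in> carr M (\<Gamma> \<union> binds L) \<psi>"
    using Cons.prems by (intro carr_mono[OF te, of \<Gamma>]) (auto simp: p)
  ultimately have "subst1 M z c \<psi> y \<in> carr M (\<Gamma> \<union> binds L) \<phi>"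
    by (rule subst1_closed)
  with Cons.IH[OF _ _ _ this] Cons.prems subst1_eqvt[OF te ext z y] show ?case
    by (auto simp: p)
qed simp

lemma swaps_carr:
  assumes "type_env \<Gamma>" "distinct (map fst L)" "fst ` set L \<inter> dom_atoms \<Gamma> = {}"
    and "\<forall>(c, b, \<psi>, y)\<in>set L. (Inl b, \<psi>) \<in> \<Gamma>" "x \<in> carr M \<Gamma> \<phi>"
  shows "act M (swaps L) x \<in> carr M (\<Gamma> \<union> binds L) \<phi>"
  using assms(2-4)
proof (induction L)
  case Nil
  then show ?case
    by (simp add: assms act_one)
next
  case (Cons p L)
  obtain c b \<psi> y where p: "p = (c, b, \<psi>, y)"
    by (metis prod_cases4)
  have te: "type_env (\<Gamma> \<union> binds L)"
    using Cons.prems assms(1) by (intro type_env_binds) auto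
  have te': "type_env (\<Gamma> \<union> binds (p # L))"
    using Cons.prems assms(1) by (intro type_env_binds) auto
  have c: "c \<notin> dom_atoms (\<Gamma> \<union> binds L)"
    using Cons.prems by (auto simp: p dom_atoms_binds)
  have b: "(Inl b, \<psi>) \<in> \<Gamma> \<union> binds L"
    using Cons.prems by (auto simp: p)
  have "act M \<langle>c \<leftrightarrow> b\<rangle> (act M (swaps L) x) \<in> carr M (perm_env \<langle>c \<leftrightarrow> b\<rangle> (\<Gamma> \<union> binds L)) \<phi>"
    using Cons by (intro act_carr te) auto
  \<comment> \<open>As \<open>c\<close> is not yet declared, the swap only moves the declaration of
    \<open>b\<close> over to \<open>c\<close>, and single-valuedness makes its type
    \<open>\<psi>\<close>.\<close>
  moreover have "perm_env \<langle>c \<leftrightarrow> b\<rangle> (\<Gamma> \<union> binds L) \<subseteq> \<Gamma> \<union> binds (p # L)"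
  proof (rule subrelI)
    fix u \<chi> assume "(u, \<chi>) \<in> perm_env \<langle>c \<leftrightarrow> b\<rangle> (\<Gamma> \<union> binds L)"
    then show "(u, \<chi>) \<in> \<Gamma> \<union> binds (p # L)"
    proof (cases rule: perm_env_cases)
      case (Inl a)
      then have "a \<noteq> c"
        using c dom_atomsI by blast
      then show ?thesis
        using Inl type_env_unique[OF te b, of \<chi>] by (cases "a = b") (auto simp: p)
    qed (simp add: p)
  qed
  ultimately show ?case
    using carr_mono[OF te'] by (simp add: p act_mult)
qed

text \<open>The swaps put \<open>x\<close> into the carrier over \<open>\<Gamma>\<close> extended by
  the fresh atoms, and the substitutions lead back to \<open>\<Gamma>\<close>. Conjugation moves
  \<open>\<pi>\<close> past the swaps.\<close>

lemma msubst_with_closed_eqvt: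
  assumes "type_env \<Gamma>" "x \<in> carr M \<Gamma> \<phi>" "typed_args M \<Gamma> \<rho>"
    and "length cs = length \<rho>" "distinct cs" "set cs \<inter> dom_atoms \<Gamma> = {}"
  shows "msubst_with M cs x \<rho> \<in> carr M \<Gamma> \<phi>
    \<and> act M \<pi> (msubst_with M cs x \<rho>)
      = msubst_with M (map (apply \<pi>) cs) (act M \<pi> x) (map (perm_triple M \<pi>) \<rho>)"
proof -
  let ?L = "zip cs \<rho>"
  have fst: "map fst ?L = cs"
    using assms(4) by simp
  have L: "distinct (map fst ?L)" "fst ` set ?L \<inter> dom_atoms \<Gamma> = {}"
    unfolding set_map[symmetric] fst using assms(5,6) by auto
  have args: "(Inl b, \<psi>) \<in> \<Gamma> \<and> y \<in> carr M \<Gamma> \<psi>" if "(c, b, \<psi>, y) \<in> set ?L" for c b \<psi> y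
    using set_zip_rightD[OF that] assms(3) unfolding typed_args_def by auto
  have "act M (swaps ?L) x \<in> carr M (\<Gamma> \<union> binds ?L) \<phi>"
    using args by (intro swaps_carr assms L) auto
  moreover have "\<forall>(c, b, \<psi>, y)\<in>set ?L. y \<in> carr M \<Gamma> \<psi>"
    using args by auto
  ultimately have "substs M (act M (swaps ?L) x) ?L \<in> carr M \<Gamma> \<phi>
    \<and> act M \<pi> (substs M (act M (swaps ?L) x) ?L)
      = substs M (act M \<pi> (act M (swaps ?L) x)) (map (perm_quad M \<pi>) ?L)"
    using substs_closed_eqvt[OF assms(1) L] by blast
  then show ?thesis
    unfolding msubst_with_def zip_perm by (simp flip: act_mult add: swaps_conjugate)
qed

text \<open>\<open>fresh_atoms\<close> does not exclude atoms declared in \<open>\<Gamma>\<close>,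
  as the previous lemma demands; shrinking the environment bridges the gap.\<close>

lemma fresh_atoms_drop:
  assumes "type_env \<Gamma>" "x \<in> carr M \<Gamma> \<phi>" "typed_args M \<Gamma> \<rho>"
    and "finite S" "S \<inter> (supp (act M) x \<union> (\<Union>(b, \<psi>, y)\<in>set \<rho>. insert b (supp (act M) y))) = {}"
  shows "x \<in> carr M (drop_atoms S \<Gamma>) \<phi>" "typed_args M (drop_atoms S \<Gamma>) \<rho>"
proof -
  show "x \<in> carr M (drop_atoms S \<Gamma>) \<phi>"
    using assms by (intro carr_drop_atoms) auto
  have "(Inl b, \<psi>) \<in> drop_atoms S \<Gamma> \<and> y \<in> carr M (drop_atoms S \<Gamma>) \<psi>" if "(b, \<psi>, y) \<in> set \<rho>" for b \<psi> y
  proof -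
    have "b \<notin> S" "S \<inter> supp (act M) y = {}"
      using assms(5) that by fastforce+
    moreover have "(Inl b, \<psi>) \<in> \<Gamma>" "y \<in> carr M \<Gamma> \<psi>"
      using assms(3) that unfolding typed_args_def by auto
    ultimately show ?thesis
      using assms(1,4) by (auto simp: drop_atoms_Inl intro: carr_drop_atoms)
  qed
  then show "typed_args M (drop_atoms S \<Gamma>) \<rho>"
    unfolding typed_args_def by auto
qed

text \<open>In the environment without both lists, every element is fixed by a permutation
  \<open>\<theta>\<close> taking \<open>cs\<close> to \<open>cs'\<close> and moving no other atoms.
  Applying \<open>\<theta>\<close> leaves the value, \<open>x\<close> and the arguments unchanged
  but turns \<open>cs\<close> into \<open>cs'\<close>.\<close>

lemma msubst_with_independent:
  assumes \<Gamma>: "type_env \<Gamma>" "x \<in> carr M \<Gamma> \<phi>" "typed_args M \<Gamma> \<rho>"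
    and cs: "fresh_atoms M x \<rho> cs" "fresh_atoms M x \<rho> cs'"
  shows "msubst_with M cs x \<rho> = msubst_with M cs' x \<rho>"
proof -
  let ?S = "set cs \<union> set cs'"
  let ?\<Delta> = "drop_atoms ?S \<Gamma>"
  obtain \<theta> where \<theta>: "map (apply \<theta>) cs = cs'" "\<And>a. a \<notin> ?S \<Longrightarrow> \<theta> \<langle>$\<rangle> a = a"
    using perm_maps_lists[of cs cs'] cs unfolding fresh_atoms_def by auto
  have te: "type_env ?\<Delta>"
    using \<Gamma>(1) by (rule type_env_drop_atoms)
  have x: "x \<in> carr M ?\<Delta> \<phi>" and args: "typed_args M ?\<Delta> \<rho>"
    using cs by (auto intro!: fresh_atoms_drop[OF \<Gamma>] simp: fresh_atoms_def Int_Un_distrib2)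
  have fixed: "act M \<theta> z = z" if "z \<in> carr M ?\<Delta> \<psi>" for z \<psi>
    using te that by (rule act_fixed_carr) (simp add: \<theta>(2) dom_drop_atoms)
  have "perm_triple M \<theta> t = t" if "t \<in> set \<rho>" for t
  proof -
    obtain b \<psi> y where t: "t = (b, \<psi>, y)"
      by (cases t)
    then show ?thesis
      using args that fixed \<theta>(2) unfolding typed_args_def by (fastforce simp: drop_atoms_Inl)
  qed
  then have "map (perm_triple M \<theta>) \<rho> = \<rho>"
    by (simp add: map_idI)
  moreover have "length cs = length \<rho>" "distinct cs" "set cs \<inter> dom_atoms ?\<Delta> = {}"
    using cs unfolding fresh_atoms_def by (auto simp: dom_drop_atoms)
  ultimately show ?thesis
    using msubst_with_closed_eqvt[OF te x args, of cs \<theta>] fixed fixed[OF x] \<theta>(1) by metis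
qed

text \<open>Justifies the choice in \<open>msubst\<close>: elements of carriers have finite support,
  so only finitely many atoms are excluded.\<close>

lemma ex_fresh_atoms:
  assumes "type_env \<Gamma>" "x \<in> carr M \<Gamma> \<phi>" "typed_args M \<Gamma> \<rho>"
  shows "\<exists>cs. fresh_atoms M x \<rho> cs"
proof -
  have "finite (supp (act M) y)" if "y \<in> carr M \<Gamma> \<psi>" for y \<psi>
    using elem_supp[OF assms(1) that] act.finite_supp by blast
  then have "finite (supp (act M) x \<union> (\<Union>(b, \<psi>, y)\<in>set \<rho>. insert b (supp (act M) y)))"
    using assms unfolding typed_args_def by fastforce
  then show ?thesis
    unfolding fresh_atoms_def using fresh_list by blast
qed

text \<open>The atoms to be avoided after applying \<open>\<pi>\<close> lie in the image of those to
  be avoided before, and an injection preserves disjointness.\<close>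

lemma fresh_atoms_eqvt:
  assumes "type_env \<Gamma>" "x \<in> carr M \<Gamma> \<phi>" "typed_args M \<Gamma> \<rho>" "fresh_atoms M x \<rho> cs"
  shows "fresh_atoms M (act M \<pi> x) (map (perm_triple M \<pi>) \<rho>) (map (apply \<pi>) cs)"
proof -
  have supp: "supp (act M) (act M \<pi> y) \<subseteq> apply \<pi> ` supp (act M) y" if "y \<in> carr M \<Gamma> \<psi>" for y \<psi>
    using elem_supp[OF assms(1) that] act.supp_act by blast
  let ?S = "\<lambda>x \<rho>. supp (act M) x \<union> (\<Union>(b, \<psi>, y)\<in>set \<rho>. insert b (supp (act M) y))"
  have "?S (act M \<pi> x) (map (perm_triple M \<pi>) \<rho>) \<subseteq> apply \<pi> ` ?S x \<rho>"
  proof -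
    have arg: "insert (\<pi> \<langle>$\<rangle> b) (supp (act M) (act M \<pi> y)) \<subseteq> apply \<pi> ` ?S x \<rho>" if "(b, \<psi>, y) \<in> set \<rho>" for b \<psi> y
    proof -
      have "supp (act M) (act M \<pi> y) \<subseteq> apply \<pi> ` supp (act M) y"
        using that assms(3) unfolding typed_args_def by (intro supp[of y \<psi>]) auto
      then have "insert (\<pi> \<langle>$\<rangle> b) (supp (act M) (act M \<pi> y)) \<subseteq> apply \<pi> ` insert b (supp (act M) y)"
        unfolding image_insert by (rule insert_mono)
      moreover have "insert b (supp (act M) y) \<subseteq> ?S x \<rho>"
        using that by blast
      ultimately show ?thesis
        by (rule subset_trans[OF _ image_mono])
    qed
    have "(\<Union>(b, \<psi>, y)\<in>set (map (perm_triple M \<pi>) \<rho>). insert b (supp (act M) y)) \<subseteq> apply \<pi> ` ?S x \<rho>"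
    proof (intro UN_least)
      fix t assume "t \<in> set (map (perm_triple M \<pi>) \<rho>)"
      then obtain b \<psi> y where "t = (\<pi> \<langle>$\<rangle> b, \<psi>, act M \<pi> y)" "(b, \<psi>, y) \<in> set \<rho>"
        by auto
      then show "(case t of (b, \<psi>, y) \<Rightarrow> insert b (supp (act M) y)) \<subseteq> apply \<pi> ` ?S x \<rho>"
        using arg by (simp only: prod.case)
    qed
    moreover have "supp (act M) (act M \<pi> x) \<subseteq> apply \<pi> ` ?S x \<rho>"
      using supp[OF assms(2)] by blast
    ultimately show ?thesis
      by (rule Un_least[rotated])
  qed
  then have "set (map (apply \<pi>) cs) \<inter> ?S (act M \<pi> x) (map (perm_triple M \<pi>) \<rho>) \<subseteq> apply \<pi> ` set cs \<inter> apply \<pi> ` ?S x \<rho>"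
    by (intro Int_mono) simp_all
  also have "\<dots> = apply \<pi> ` (set cs \<inter> ?S x \<rho>)"
    by (rule image_Int[symmetric]) (simp add: inj_def apply_inj)
  also have "\<dots> = {}"
    using assms(4) unfolding fresh_atoms_def by blast
  finally show ?thesis
    using assms(4) unfolding fresh_atoms_def
    by (simp add: distinct_map inj_on_def apply_inj)
qed

lemma msubst_closed_eqvt:
  assumes \<Gamma>: "type_env \<Gamma>" "x \<in> carr M \<Gamma> \<phi>" "typed_args M \<Gamma> \<rho>"
  shows "msubst M x \<rho> \<in> carr M \<Gamma> \<phi>"
    and "act M \<pi> (msubst M x \<rho>) = msubst M (act M \<pi> x) (map (perm_triple M \<pi>) \<rho>)"
proof -
  define cs where "cs = (SOME cs. fresh_atoms M x \<rho> cs)"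
  have cs: "fresh_atoms M x \<rho> cs"
    unfolding cs_def by (rule someI_ex[OF ex_fresh_atoms[OF \<Gamma>]])
  have eq: "msubst M x \<rho> = msubst_with M cs x \<rho>"
    unfolding cs_def by (rule msubst_eq_msubst_with)
  let ?\<Delta> = "drop_atoms (set cs) \<Gamma>"
  have *: "msubst_with M cs x \<rho> \<in> carr M ?\<Delta> \<phi>
    \<and> act M \<pi> (msubst_with M cs x \<rho>)
      = msubst_with M (map (apply \<pi>) cs) (act M \<pi> x) (map (perm_triple M \<pi>) \<rho>)"
    using cs unfolding fresh_atoms_def
    by (intro msubst_with_closed_eqvt type_env_drop_atoms fresh_atoms_drop[OF \<Gamma>] \<Gamma>(1))
      (auto simp: dom_drop_atoms)
  then show "msubst M x \<rho> \<in> carr M \<Gamma> \<phi>"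
    unfolding eq using carr_mono[OF \<Gamma>(1) drop_atoms_subset] by blast
  have "typed_args M (perm_env \<pi> \<Gamma>) (map (perm_triple M \<pi>) \<rho>)"
    using \<Gamma>(3) unfolding typed_args_def by (fastforce intro: perm_env_Inl act_carr[OF \<Gamma>(1)])
  note \<pi>\<Gamma> = type_env_perm_env[OF \<Gamma>(1)] act_carr[OF \<Gamma>(1,2)] this
  \<comment> \<open>The permuted \<open>cs\<close> are fresh for the permuted data but need not be
    the ones \<open>msubst\<close> picks there; independence of the choice identifies the two
    values.\<close>
  have "msubst_with M (map (apply \<pi>) cs) (act M \<pi> x) (map (perm_triple M \<pi>) \<rho>)
    = msubst M (act M \<pi> x) (map (perm_triple M \<pi>) \<rho>)"
    unfolding msubst_eq_msubst_with
    by (rule msubst_with_independent[OF \<pi>\<Gamma>]) (rule fresh_atoms_eqvt[OF \<Gamma> cs], rule someI_ex[OF ex_fresh_atoms[OF \<pi>\<Gamma>]])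
  with * show "act M \<pi> (msubst M x \<rho>) = msubst M (act M \<pi> x) (map (perm_triple M \<pi>) \<rho>)"
    unfolding eq by simp
qed

end

section \<open>Interpretation of typed terms\<close>

lemma interp_At_iff:
  "interp M \<nu> \<Gamma> (At a) y \<longleftrightarrow> (\<exists>\<phi>. (Inl a, \<phi>) \<in> \<Gamma> \<and> y = atom_sem M a \<phi>)"
proof
  assume "interp M \<nu> \<Gamma> (At a) y"
  then show "\<exists>\<phi>. (Inl a, \<phi>) \<in> \<Gamma> \<and> y = atom_sem M a \<phi>"
    by cases (auto dest: At_inj simp: trm_distinct)
qed (auto intro: interp.intros)

lemma interp_Con_iff: "interp M \<nu> \<Gamma> (Con C) y \<longleftrightarrow> y = const_sem M C"
proof
  assume "interp M \<nu> \<Gamma> (Con C) y"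
  then show "y = const_sem M C"
    by cases (auto dest: Con_inj simp: trm_distinct trm_distinct[symmetric])
qed (auto intro: interp.intros)

lemma interp_App_iff:
  "interp M \<nu> \<Gamma> (App r s) z \<longleftrightarrow> (\<exists>x y. interp M \<nu> \<Gamma> r x \<and> interp M \<nu> \<Gamma> s y \<and> z = appl M x y)"
proof
  assume "interp M \<nu> \<Gamma> (App r s) z"
  then show "\<exists>x y. interp M \<nu> \<Gamma> r x \<and> interp M \<nu> \<Gamma> s y \<and> z = appl M x y"
    by cases (auto dest!: App_inj simp: trm_distinct trm_distinct[symmetric])
qed (auto intro: interp.intros)

text \<open>A derivation may have used any representative with an undeclared binder, so inversion
  yields only an equation between abstractions.\<close>

lemma interp_LamE:
  assumes "interp M \<nu> \<Gamma> (Lam a \<phi> r) y" "a \<in> Au"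
  obtains b \<psi> s x where "b \<in> Au - dom_atoms \<Gamma>" "Lam a \<phi> r = Lam b \<psi> s"
    "interp M \<nu> (env_ext \<Gamma> b \<psi>) s x" "y = absn M b \<psi> x"
  using assms(1)
proof cases
  case (interp_Lam b \<psi> s x)
  then show ?thesis
    using that by blast
qed (use assms(2) in \<open>simp_all add: trm_distinct trm_distinct[symmetric]\<close>)

lemma interp_UnkE:
  assumes "interp M \<nu> \<Gamma> (Unk X \<sigma>) y" "distinct_Ad \<sigma>"
  obtains \<rho> where "list_all2 (\<lambda>p q. fst q = fst p \<and> (Inl (fst p), fst (snd q)) \<in> \<Gamma> \<and>
      interp M \<nu> \<Gamma> (snd p) (snd (snd q))) \<sigma> \<rho>" "y = msubst M (\<nu> X) \<rho>"
  using assms(1)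
proof cases
  case (interp_Unk \<tau> Y \<phi> \<rho>)
  then show ?thesis
    using Unk_inj[OF assms(2) interp_Unk(3,1)] that by blast
qed (use assms(2) in \<open>simp_all add: trm_distinct trm_distinct[symmetric]\<close>)

section \<open>Unique interpretations under renaming and weakening\<close>

context nominal_model
begin

lemma interp_typed_Lam:
  assumes a: "a \<in> Au" and \<Gamma>: "type_env \<Gamma>" "type_env (env_ext \<Gamma> a \<phi>)"
    and x: "x \<in> carr M (env_ext \<Gamma> a \<phi>) \<psi>"
    and IH: "\<And>\<pi> \<Delta> y. fixes_Ad \<pi> \<Longrightarrow> type_env \<Delta> \<Longrightarrow> perm_env \<pi> (env_ext \<Gamma> a \<phi>) \<subseteq> \<Delta> \<Longrightarrow>
      interp M \<nu> \<Delta> (perm_trm \<pi> r) y \<longleftrightarrow> y = act M \<pi> x"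
    and \<pi>: "fixes_Ad \<pi>" and \<Delta>: "type_env \<Delta>" "perm_env \<pi> \<Gamma> \<subseteq> \<Delta>"
  shows "interp M \<nu> \<Delta> (perm_trm \<pi> (Lam a \<phi> r)) y \<longleftrightarrow> y = act M \<pi> (absn M a \<phi> x)"
proof -
  let ?w = "absn M a \<phi> x" and ?a = "\<pi> \<langle>$\<rangle> a"
  have a': "?a \<in> Au"
    using a \<pi> by (simp add: fixes_Ad_in_Au)
  have perm: "perm_trm \<pi> (Lam a \<phi> r) = Lam ?a \<phi> (perm_trm \<pi> r)"
    using \<pi> a by (rule perm_trm_Lam)
  \<comment> \<open>Removing \<open>a\<close> from \<open>\<Gamma>\<close> first shows that the
    abstraction does not depend on its binder, even when \<open>\<Gamma>\<close> declares
    \<open>a\<close>.\<close>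
  have w: "act M \<pi> ?w \<in> carr M (perm_env \<pi> (drop_atoms {a} \<Gamma>)) (\<phi> \<rightarrow>\<^sub>t \<psi>)"
    using x \<Gamma> by (intro act_carr absn_closed type_env_drop_atoms) (simp_all add: env_ext_drop)
  \<comment> \<open>The permutation \<open>\<rho>\<close> sends \<open>a\<close> to the binder
    \<open>b\<close> in use and agrees with \<open>\<pi>\<close> on the other atoms that matter. It
    passes through a third atom \<open>c\<close> because \<open>Lam_eqD\<close> compares bodies only
    after such swaps; \<open>c = b\<close> is allowed.\<close>
  have key: "fixes_Ad \<rho> \<and> absn M b \<phi> (act M \<rho> x) = act M \<pi> ?w \<and>
      (interp M \<nu> (env_ext \<Delta> b \<phi>) (perm_trm \<rho> r) z \<longleftrightarrow> z = act M \<rho> x)"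
    if b: "b \<in> Au - dom_atoms \<Delta>" and c: "c \<in> Au - dom_atoms \<Delta>"
      and \<rho>: "\<rho> = \<langle>c \<leftrightarrow> b\<rangle> * (\<langle>c \<leftrightarrow> ?a\<rangle> * \<pi>)" for b c \<rho> z
  proof (intro conjI)
    show fix_\<rho>: "fixes_Ad \<rho>"
      unfolding \<rho> using a' b c \<pi> by (intro fixes_Ad_times fixes_Ad_swap) auto
    have \<rho>a: "\<rho> \<langle>$\<rangle> a = b"
      unfolding \<rho> by (simp add: apply_times)
    have \<rho>_eq: "\<rho> \<langle>$\<rangle> e = \<pi> \<langle>$\<rangle> e" if "e \<noteq> a" "\<pi> \<langle>$\<rangle> e \<in> dom_atoms \<Delta>" for e
    proof -
      have "\<pi> \<langle>$\<rangle> e \<noteq> ?a" "\<pi> \<langle>$\<rangle> e \<noteq> b" "\<pi> \<langle>$\<rangle> e \<noteq> c"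
        using that b c by (auto simp: apply_inj)
      then show ?thesis
        unfolding \<rho> by (simp add: apply_times)
    qed
    have "absn M b \<phi> (act M \<rho> x) = act M \<rho> ?w"
      by (simp add: absn_eqvt[OF \<Gamma> x] \<rho>a)
    also have "\<dots> = act M (\<langle>c \<leftrightarrow> b\<rangle> * \<langle>c \<leftrightarrow> ?a\<rangle>) (act M \<pi> ?w)"
      by (simp add: \<rho> mult.assoc flip: act_mult)
    \<comment> \<open>The swaps move at most \<open>b\<close>, \<open>c\<close> and
      \<open>\<pi> \<langle>$\<rangle> a\<close>, none of which is declared in the environment given
      by \<open>w\<close>.\<close>
    also have "\<dots> = act M \<pi> ?w"
    proof (rule act_fixed_carr[OF _ w])
      show "type_env (perm_env \<pi> (drop_atoms {a} \<Gamma>))"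
        using \<Gamma>(1) by (intro type_env_perm_env type_env_drop_atoms)
      fix e assume "e \<in> dom_atoms (perm_env \<pi> (drop_atoms {a} \<Gamma>))"
      then have "e \<noteq> ?a" "e \<in> dom_atoms \<Delta>"
        using dom_atoms_mono[OF \<Delta>(2)] by (auto simp: dom_atoms_perm_env dom_drop_atoms apply_inj)
      moreover from this have "e \<noteq> b" "e \<noteq> c"
        using b c by auto
      ultimately show "(\<langle>c \<leftrightarrow> b\<rangle> * \<langle>c \<leftrightarrow> ?a\<rangle>) \<langle>$\<rangle> e = e"
        by (simp add: apply_times)
    qed
    finally show "absn M b \<phi> (act M \<rho> x) = act M \<pi> ?w" .
    \<comment> \<open>This inclusion is what the induction hypothesis for the body asks of
      \<open>\<rho>\<close> and the environment \<open>env_ext \<Delta> b \<phi>\<close>.\<close>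
    have "perm_env \<rho> (env_ext \<Gamma> a \<phi>) \<subseteq> env_ext \<Delta> b \<phi>"
    proof (rule subrelI)
      fix u \<chi> assume "(u, \<chi>) \<in> perm_env \<rho> (env_ext \<Gamma> a \<phi>)"
      then show "(u, \<chi>) \<in> env_ext \<Delta> b \<phi>"
      proof (cases rule: perm_env_cases)
        case (Inl e)
        show ?thesis
        proof (cases "e = a")
          case True
          then show ?thesis
            using Inl type_env_unique[OF \<Gamma>(2), of "Inl a" \<phi> \<chi>] by (simp add: \<rho>a)
        next
          case False
          then have "(Inl (\<pi> \<langle>$\<rangle> e), \<chi>) \<in> \<Delta>"
            using Inl perm_env_Inl[of e \<chi> \<Gamma> \<pi>] \<Delta>(2) by auto
          then show ?thesis
            using Inl \<rho>_eq[OF False] dom_atomsI by (metis insertCI)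
        qed
      next
        case (Inr X)
        then have "(Inr X, \<chi>) \<in> perm_env \<pi> \<Gamma>"
          unfolding perm_env_def by force
        then show ?thesis
          using Inr \<Delta>(2) by auto
      qed
    qed
    then show "interp M \<nu> (env_ext \<Delta> b \<phi>) (perm_trm \<rho> r) z \<longleftrightarrow> z = act M \<rho> x"
      using b by (intro IH fix_\<rho> type_env_ext \<Delta>) auto
  qed
  have fresh: "\<exists>c. c \<in> Au - dom_atoms \<Delta> \<and> c \<notin> L" if "finite L" for L
    using that finite_dom_atoms[OF \<Delta>(1)] fresh_Au[of "L \<union> dom_atoms \<Delta>"] by auto
  show ?thesis
  proof
    assume "interp M \<nu> \<Delta> (perm_trm \<pi> (Lam a \<phi> r)) y"
    then obtain b \<chi> s z where b: "b \<in> Au - dom_atoms \<Delta>"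
      and eq: "Lam ?a \<phi> (perm_trm \<pi> r) = Lam b \<chi> s"
      and z: "interp M \<nu> (env_ext \<Delta> b \<chi>) s z" "y = absn M b \<chi> z"
      unfolding perm using a' by (rule interp_LamE)
    from Lam_eqD[OF a' _ eq] b obtain L where \<chi>: "\<chi> = \<phi>" and L: "finite L"
      "\<And>c. c \<in> Au - L \<Longrightarrow> perm_trm \<langle>c \<leftrightarrow> ?a\<rangle> (perm_trm \<pi> r) = perm_trm \<langle>c \<leftrightarrow> b\<rangle> s"
      by auto
    obtain c where c: "c \<in> Au - dom_atoms \<Delta>" "c \<notin> L"
      using fresh[OF L(1)] by blast
    let ?\<rho> = "\<langle>c \<leftrightarrow> b\<rangle> * (\<langle>c \<leftrightarrow> ?a\<rangle> * \<pi>)"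
    have fix_swaps: "fixes_Ad \<langle>c \<leftrightarrow> b\<rangle>" "fixes_Ad \<langle>c \<leftrightarrow> ?a\<rangle>"
      using a' b c by (auto intro: fixes_Ad_swap)
    \<comment> \<open>Swapping \<open>c\<close> and \<open>b\<close> a second time cancels the swap
      on \<open>s\<close>, so the body found by inversion is a renaming of \<open>r\<close> covered
      by \<open>key\<close>.\<close>
    have "perm_trm ?\<rho> r = perm_trm \<langle>c \<leftrightarrow> b\<rangle> (perm_trm \<langle>c \<leftrightarrow> b\<rangle> s)"
      using L(2)[of c] c fix_swaps \<pi> by (simp add: perm_trm_times fixes_Ad_times)
    also have "\<dots> = s"
      using fix_swaps by (simp flip: perm_trm_times add: perm_trm_one)
    finally have "z = act M ?\<rho> x"
      using z(1) key[OF b c(1) refl, of z] by (simp add: \<chi>)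
    then show "y = act M \<pi> ?w"
      using z(2) key[OF b c(1) refl, of z] by (simp add: \<chi>)
  next
    assume y: "y = act M \<pi> ?w"
    obtain L where L: "finite L"
      "\<And>c. c \<in> Au - L \<Longrightarrow> Lam c \<phi> (perm_trm \<langle>c \<leftrightarrow> ?a\<rangle> (perm_trm \<pi> r)) = Lam ?a \<phi> (perm_trm \<pi> r)"
      using Lam_rename[OF a', of \<phi> "perm_trm \<pi> r"] by blast
    obtain c where c: "c \<in> Au - dom_atoms \<Delta>" "c \<notin> L"
      using fresh[OF L(1)] by blast
    \<comment> \<open>For existence the binder itself is renamed to an undeclared \<open>c\<close>.
      This is \<open>key\<close> with \<open>b = c\<close>, whose outer swap is the
      identity.\<close>
    let ?\<rho> = "\<langle>c \<leftrightarrow> ?a\<rangle> * \<pi>"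
    have "interp M \<nu> (env_ext \<Delta> c \<phi>) (perm_trm ?\<rho> r) (act M ?\<rho> x)"
      "absn M c \<phi> (act M ?\<rho> x) = act M \<pi> ?w"
      using key[OF c(1) c(1), of ?\<rho>] by auto
    then have "interp M \<nu> \<Delta> (Lam c \<phi> (perm_trm ?\<rho> r)) (act M \<pi> ?w)"
      using interp.interp_Lam[OF c(1)] by metis
    moreover have "perm_trm ?\<rho> r = perm_trm \<langle>c \<leftrightarrow> ?a\<rangle> (perm_trm \<pi> r)"
      using a' c \<pi> by (intro perm_trm_times fixes_Ad_swap) auto
    ultimately show "interp M \<nu> \<Delta> (perm_trm \<pi> (Lam a \<phi> r)) y"
      using L(2)[of c] c unfolding perm y by auto
  qed
qed

text \<open>\<open>f\<close> and \<open>g\<close> give the type and value of each argument. Types in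
  \<open>\<Delta>\<close> and interpretations of the arguments are unique, so only one list fits
  \<open>interp_Unk\<close>; since \<open>\<pi>\<close> fixes the \<open>b\<close> and the value of
  \<open>X\<close>, equivariance of \<open>msubst\<close> gives its result.\<close>

lemma interp_typed_Unk:
  assumes "distinct_Ad \<sigma>" "(Inr X, \<phi>) \<in> \<Gamma>" "type_env \<Gamma>" "models M \<Gamma> \<nu>" "valuation M \<nu>"
    and f: "\<And>p. p \<in> set \<sigma> \<Longrightarrow> (Inl (fst p), f p) \<in> \<Gamma>"
    and g: "\<And>p. p \<in> set \<sigma> \<Longrightarrow> g p \<in> carr M \<Gamma> (f p)"
    and IH: "\<And>p y. p \<in> set \<sigma> \<Longrightarrow> interp M \<nu> \<Delta> (perm_trm \<pi> (snd p)) y \<longleftrightarrow> y = act M \<pi> (g p)"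
    and \<pi>: "fixes_Ad \<pi>" and \<Delta>: "type_env \<Delta>" "perm_env \<pi> \<Gamma> \<subseteq> \<Delta>"
  shows "interp M \<nu> \<Delta> (perm_trm \<pi> (Unk X \<sigma>)) y \<longleftrightarrow>
    y = act M \<pi> (msubst M (\<nu> X) (map (\<lambda>p. (fst p, f p, g p)) \<sigma>))"
proof -
  let ?\<rho> = "map (\<lambda>p. (fst p, f p, act M \<pi> (g p))) \<sigma>"
  let ?\<sigma> = "map (map_prod id (perm_trm \<pi>)) \<sigma>"
  have dist: "distinct_Ad ?\<sigma>"
    using assms(1) by (auto simp: image_comp)
  have b: "\<pi> \<langle>$\<rangle> (fst p) = fst p" if "p \<in> set \<sigma>" for p
    using assms(1) \<pi> that by (auto intro: fixes_Ad_apply)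
  have f\<Delta>: "(Inl (fst p), f p) \<in> \<Delta>" if "p \<in> set \<sigma>" for p
    using perm_env_Inl[OF f[OF that], of \<pi>] b[OF that] \<Delta>(2) by auto
  have X: "(Inr X, \<phi>) \<in> \<Delta>"
    using \<Delta>(2) assms(2) unfolding perm_env_def by force
  have X_fixed: "act M \<pi> (\<nu> X) = \<nu> X"
    using assms(5) \<pi> unfolding valuation_def
    by (intro act.fixed_if_supp) (auto intro: fixes_Ad_apply)
  have args: "typed_args M \<Gamma> (map (\<lambda>p. (fst p, f p, g p)) \<sigma>)"
    using f g unfolding typed_args_def by auto
  have X_carr: "\<nu> X \<in> carr M \<Gamma> \<phi>"
    using assms(2,4) unfolding models_def by blast
  have \<rho>_map: "map (perm_triple M \<pi>) (map (\<lambda>p. (fst p, f p, g p)) \<sigma>) = ?\<rho>"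
    using b by simp
  have eqvt: "act M \<pi> (msubst M (\<nu> X) (map (\<lambda>p. (fst p, f p, g p)) \<sigma>)) = msubst M (\<nu> X) ?\<rho>"
    by (simp only: msubst_closed_eqvt(2)[OF assms(3) X_carr args] X_fixed \<rho>_map)
  let ?R = "\<lambda>p q. fst q = fst p \<and> (Inl (fst p), fst (snd q)) \<in> \<Delta> \<and> interp M \<nu> \<Delta> (snd p) (snd (snd q))"
  have R: "?R (map_prod id (perm_trm \<pi>) p) q \<longleftrightarrow> q = (fst p, f p, act M \<pi> (g p))" if "p \<in> set \<sigma>" for p q
  proof -
    have "(Inl (fst p), \<chi>) \<in> \<Delta> \<longleftrightarrow> \<chi> = f p" for \<chi>
      using f\<Delta>[OF that] type_env_unique[OF \<Delta>(1)] by blast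
    then show ?thesis
      by (cases q) (simp add: IH[OF that])
  qed
  have all2: "list_all2 ?R ?\<sigma> \<rho> \<longleftrightarrow> \<rho> = ?\<rho>" for \<rho>
  proof
    assume "list_all2 ?R ?\<sigma> \<rho>"
    then show "\<rho> = ?\<rho>"
      using R by (intro nth_equalityI) (auto simp: list_all2_conv_all_nth)
  next
    assume "\<rho> = ?\<rho>"
    then show "list_all2 ?R ?\<sigma> \<rho>"
      using f\<Delta> IH by (auto simp: list_all2_conv_all_nth)
  qed
  show ?thesis
    unfolding eqvt perm_trm_Unk[OF \<pi> assms(1)]
  proof
    assume "interp M \<nu> \<Delta> (Unk X ?\<sigma>) y"
    then show "y = msubst M (\<nu> X) ?\<rho>"
      using dist by (rule interp_UnkE) (simp add: all2)
  next
    assume "y = msubst M (\<nu> X) ?\<rho>"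
    then show "interp M \<nu> \<Delta> (Unk X ?\<sigma>) y"
      using interp.interp_Unk[OF dist X] all2 by blast
  qed
qed

lemma models_env_ext:
  "type_env (env_ext \<Gamma> a \<phi>) \<Longrightarrow> models M \<Gamma> \<nu> \<Longrightarrow> models M (env_ext \<Gamma> a \<phi>) \<nu>"
  unfolding models_def by (blast intro: carr_mono)

lemma interp_typed:
  assumes "typing type \<Gamma> r \<phi>" "valuation M \<nu>" "type_env \<Gamma>" "models M \<Gamma> \<nu>"
  shows "\<exists>x\<in>carr M \<Gamma> \<phi>. \<forall>\<pi> \<Delta> y. fixes_Ad \<pi> \<longrightarrow> type_env \<Delta> \<longrightarrow> perm_env \<pi> \<Gamma> \<subseteq> \<Delta> \<longrightarrow>
    (interp M \<nu> \<Delta> (perm_trm \<pi> r) y \<longleftrightarrow> y = act M \<pi> x)"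
  using assms(1,3,4)
proof (induction rule: typing.induct)
  case (typing_At a \<phi> \<Gamma>)
  have "interp M \<nu> \<Delta> (perm_trm \<pi> (At a)) y \<longleftrightarrow> y = act M \<pi> (atom_sem M a \<phi>)"
    if "fixes_Ad \<pi>" "type_env \<Delta>" "perm_env \<pi> \<Gamma> \<subseteq> \<Delta>" for \<pi> \<Delta> y
  proof -
    have "(Inl (\<pi> \<langle>$\<rangle> a), \<phi>) \<in> \<Delta>"
      using perm_env_Inl typing_At.hyps that(3) by blast
    then show ?thesis
      using type_env_unique[OF that(2)]
      by (auto simp: perm_trm_At[OF that(1)] interp_At_iff atom_eqvt)
  qed
  then show ?case
    using atom_closed typing_At by blast
next
  case (typing_Con \<Gamma> C)
  then show ?case
    by (intro bexI[of _ "const_sem M C"]) (simp_all add: perm_trm_Con interp_Con_iff const_eqvt const_closed)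
next
  case (typing_Lam a \<Gamma> \<phi> r \<psi>)
  then obtain x where x: "x \<in> carr M (env_ext \<Gamma> a \<phi>) \<psi>" "\<And>\<pi> \<Delta> y. fixes_Ad \<pi> \<Longrightarrow> type_env \<Delta> \<Longrightarrow>
      perm_env \<pi> (env_ext \<Gamma> a \<phi>) \<subseteq> \<Delta> \<Longrightarrow> interp M \<nu> \<Delta> (perm_trm \<pi> r) y \<longleftrightarrow> y = act M \<pi> x"
    using models_env_ext by blast
  show ?case
  proof (intro bexI allI impI)
    show "absn M a \<phi> x \<in> carr M \<Gamma> (\<phi> \<rightarrow>\<^sub>t \<psi>)"
      using typing_Lam x by (intro absn_closed)
  qed (rule interp_typed_Lam[OF typing_Lam.hyps(1) typing_Lam.prems(1) typing_Lam.hyps(2) x])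
next
  case (typing_App \<Gamma> r \<phi> \<psi> s)
  then obtain x y where x: "x \<in> carr M \<Gamma> (\<phi> \<rightarrow>\<^sub>t \<psi>)" "\<And>\<pi> \<Delta> y. fixes_Ad \<pi> \<Longrightarrow> type_env \<Delta> \<Longrightarrow>
      perm_env \<pi> \<Gamma> \<subseteq> \<Delta> \<Longrightarrow> interp M \<nu> \<Delta> (perm_trm \<pi> r) y \<longleftrightarrow> y = act M \<pi> x"
    and y: "y \<in> carr M \<Gamma> \<phi>" "\<And>\<pi> \<Delta> z. fixes_Ad \<pi> \<Longrightarrow> type_env \<Delta> \<Longrightarrow>
      perm_env \<pi> \<Gamma> \<subseteq> \<Delta> \<Longrightarrow> interp M \<nu> \<Delta> (perm_trm \<pi> s) z \<longleftrightarrow> z = act M \<pi> y"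
    by metis
  show ?case
  proof (intro bexI allI impI)
    show "appl M x y \<in> carr M \<Gamma> \<psi>"
      using typing_App x y by (blast intro: appl_closed)
  qed (simp add: perm_trm_App interp_App_iff x y appl_eqvt[OF typing_App.prems(1) x(1) y(1)])
next
  case (typing_Meta \<sigma> X \<phi> \<Gamma>)
  let ?P = "\<lambda>p \<psi> x. (Inl (fst p), \<psi>) \<in> \<Gamma> \<and> x \<in> carr M \<Gamma> \<psi> \<and>
    (\<forall>\<pi> \<Delta> y. fixes_Ad \<pi> \<longrightarrow> type_env \<Delta> \<longrightarrow> perm_env \<pi> \<Gamma> \<subseteq> \<Delta> \<longrightarrow>
      (interp M \<nu> \<Delta> (perm_trm \<pi> (snd p)) y \<longleftrightarrow> y = act M \<pi> x))"
  \<comment> \<open>The rule offers a type, and the induction hypothesis a value, separately for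
    each argument; choice then collects them into functions on the entries of
    \<open>\<sigma>\<close>.\<close>
  have "\<forall>p\<in>set \<sigma>. \<exists>\<psi> x. ?P p \<psi> x"
    using typing_Meta.IH typing_Meta.prems by fastforce
  then obtain f g where fg: "\<And>p. p \<in> set \<sigma> \<Longrightarrow> ?P p (f p) (g p)"
    by metis
  show ?case
  proof (intro bexI allI impI)
    have "typed_args M \<Gamma> (map (\<lambda>p. (fst p, f p, g p)) \<sigma>)"
      using fg unfolding typed_args_def by auto
    then show "msubst M (\<nu> X) (map (\<lambda>p. (fst p, f p, g p)) \<sigma>) \<in> carr M \<Gamma> \<phi>"
      using typing_Meta.prems typing_Meta.hyps(2) unfolding models_def
      by (intro msubst_closed_eqvt(1)) auto
  qed (rule interp_typed_Unk[OF typing_Meta.hyps typing_Meta.prems assms(2)], use fg in auto)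
qed

end

theorem theorem5p11:
  fixes type :: "'c \<Rightarrow> 'b ty"
    and M :: "('b, 'c, 'x, 'd) model"
    and \<nu> :: "'x \<Rightarrow> 'd"
    and \<Gamma> :: "('b, 'x) env"
    and r :: "('b, 'c, 'x) trm"
    and \<phi> :: "'b ty"
  assumes "nominal_model type M"
    and "type_env \<Gamma>"
    and "valuation M \<nu>"
    and "models M \<Gamma> \<nu>"
    and "typing type \<Gamma> r \<phi>"
  shows "denote M \<nu> \<Gamma> r \<in> carr M \<Gamma> \<phi>"
proof -
  interpret nominal_model type M
    by (rule assms(1))
  \<comment> \<open>Taking the identity for \<open>\<pi>\<close> and \<open>\<Gamma>\<close> for
    \<open>\<Delta>\<close> makes \<open>x\<close> the unique interpretation of \<open>r\<close>,
    hence the value of the definite description in \<open>denote\<close>.\<close>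
  obtain x where x: "x \<in> carr M \<Gamma> \<phi>" and "\<And>y. interp M \<nu> \<Gamma> (perm_trm 1 r) y \<longleftrightarrow> y = act M 1 x"
    using interp_typed[OF assms(5,3,2,4)] fixes_Ad_one assms(2) perm_env_one by (metis subset_refl)
  then have "\<And>y. interp M \<nu> \<Gamma> r y \<longleftrightarrow> y = x"
    by (simp add: perm_trm_one act_one)
  then have "denote M \<nu> \<Gamma> r = x"
    unfolding denote_def by (intro the_equality) simp_all
  with x show ?thesis
    by simp
qed

end
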